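(* Suppose the running cost $L$ satisfies the Tonelli conditions and the vector fields $f_0,\dots,f_n$ satisfy the sublinear growth assumption. Let $\mu_0,\mu_T\in\mathcal{P}(\mathbb{R}^d)$ and let $\gamma\in\Pi$, where $\Pi$ is the set of Borel probability measures on $\mathbb{R}^d\times\mathbb{R}^d$ with first marginal $\mu_0$ and second marginal $\mu_T$. Suppose $S:\mathbb{R}^d\times\mathbb{R}^d\to\Omega$ is a measurable map, defined $\gamma$-almost everywhere, such that $$S^\omega_0(x,y)=x,\qquad S^\omega_T(x,y)=y$$ for $\gamma$-almost every $(x,y)$, and $$\int_0^T\int_{\mathbb{R}^d\times\mathbb{R}^d}L(t,S^\omega_t(x,y),S^u_t(x,y))\,d\gamma(x,y)\,dt<\infty.$$ Then there exists a pair $(\mu,u)$ that solves the continuity equation in the weak sense, such that $\mu_0=\pi^1_\#\gamma$ and $\mu_T=\pi^2_\#\gamma$, and $u(t,\cdot)\in L^p(\mu_t)$ for almost every $t\in[0,T]$.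
   Context: Let $d,n\ge 1$, $T>0$, $I=[0,T]$, $U\subseteq\mathbb{R}^n$ (the control set), $f_0,\dots,f_n:\mathbb{R}^d\to\mathbb{R}^d$ vector fields, and $f(x,u)=f_0(x)+\sum_{i=1}^n u_i f_i(x)$. Tonelli conditions on $L:[0,T]\times\mathbb{R}^d\times U\to\mathbb{R}$: (1) $L$ is continuous; (2) $U$ is closed and convex, and either (a) there exist $p>1$, $\alpha>0$, $\beta\in\mathbb{R}$ with $L(t,x,u)\ge\alpha|u|^p+\beta$ for all $(t,x,u)$, or (b) $U$ is compact; (3) $L(t,x,\cdot)$ is convex for each $(t,x)$. Sublinear growth assumption: each $f_i$ ($i=0,\dots,n$) is $C^1$ and there is $M>0$ with $|f_i(x)|\le M(|x|+1)$ for all $x$ and all $i$. Fix $p\ge1$; under alternative (a), $p$ is the exponent in (a). Let $\mathcal{U}=\{u\in L^p(0,T;\mathbb{R}^n):u(t)\in U\text{ for a.e. }t\}$ and let $\Omega$ be the set of pairs $(\omega,u)\in C([0,T];\mathbb{R}^d)\times\mathcal{U}$ satisfying $\dot\omega(t)=f(\omega(t),u(t))$ for a.e. $t$. For a map $S$ into $\Omega$ with $S(x,y)=(\ell,\alpha)$, write $S^\omega_t(x,y)=\ell(t)$ and $S^u_t(x,y)=\alpha(t)$. $\pi^1,\pi^2:\mathbb{R}^d\times\mathbb{R}^d\to\mathbb{R}^d$ are the coordinate projections. A pair $(\mu,u)$, with $u:I\times\mathbb{R}^d\to U$ measurable and $\mu:I\to\mathcal{P}(\mathbb{R}^d)$ narrowly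 continuous, solves the continuity equation in the weak sense if for all $\phi\in C^1_c(I\times\mathbb{R}^d)$ $$\int_I\int_{\mathbb{R}^d}[\partial_t\phi+\partial_x\phi\cdot f(x,u(t,x))]\,d\mu_t(x)\,dt=\int\phi(T,x)\,d\mu_T(x)-\int\phi(0,x)\,d\mu_0(x).$$
   Formalization: The trajectories ω in Ω are required to be absolutely continuous, not merely continuous with the differential equation holding almost everywhere; with mere continuity the claim fails (all f_i = 0 and a Cantor-type path from x to y). *)

theory Defs
  imports "HOL-Probability.Probability"
begin

section \<open>Control system and running cost\<close>

definition ctrl_field ::
  "(real^'d \<Rightarrow> real^'d) \<Rightarrow> ('n \<Rightarrow> real^'d \<Rightarrow> real^'d) \<Rightarrow> real^'d \<Rightarrow> real^'n \<Rightarrow> real^'d" where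
  "ctrl_field f0 f x u = f0 x + (\<Sum>i\<in>UNIV. (u $ i) *\<^sub>R f i x)"

definition C1_map :: "(real^'d \<Rightarrow> real^'d) \<Rightarrow> bool" where
  "C1_map g \<longleftrightarrow>
     (\<exists>g'. (\<forall>x. (g has_derivative blinfun_apply (g' x)) (at x)) \<and> continuous_on UNIV g')"

definition sublinear_growth ::
  "(real^'d \<Rightarrow> real^'d) \<Rightarrow> ('n::finite \<Rightarrow> real^'d \<Rightarrow> real^'d) \<Rightarrow> bool" where
  "sublinear_growth f0 f \<longleftrightarrow>
     C1_map f0 \<and> (\<forall>i. C1_map (f i)) \<and>
     (\<exists>M>0. \<forall>x. norm (f0 x) \<le> M * (norm x + 1) \<and> (\<forall>i. norm (f i x) \<le> M * (norm x + 1)))"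

text \<open>In the superlinear alternative the growth exponent is the \<open>p\<close> of the control space;
  if \<open>U\<close> is compact, \<open>p\<close> is not constrained here.\<close>

definition tonelli ::
  "real \<Rightarrow> (real^'n) set \<Rightarrow> real \<Rightarrow> (real \<Rightarrow> real^'d \<Rightarrow> real^'n \<Rightarrow> real) \<Rightarrow> bool" where
  "tonelli T U p L \<longleftrightarrow>
     continuous_on ({0..T} \<times> UNIV \<times> U) (\<lambda>(t, x, u). L t x u) \<and>
     closed U \<and> convex U \<and>
     ((p > 1 \<and> (\<exists>\<alpha>>0. \<exists>\<beta>. \<forall>t\<in>{0..T}. \<forall>x. \<forall>u\<in>U. L t x u \<ge> \<alpha> * norm u powr p + \<beta>))
      \<or> compact U) \<and>
     (\<forall>t\<in>{0..T}. \<forall>x. convex_on U (L t x))"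

section \<open>The space of admissible trajectories\<close>

definition Lp_functions :: "'a measure \<Rightarrow> real \<Rightarrow> ('a \<Rightarrow> 'b::euclidean_space) set" where
  "Lp_functions M p = {g \<in> borel_measurable M. integrable M (\<lambda>x. norm (g x) powr p)}"

definition absolutely_continuous_on :: "real \<Rightarrow> real \<Rightarrow> (real \<Rightarrow> 'b::real_normed_vector) \<Rightarrow> bool" where
  "absolutely_continuous_on a b \<omega> \<longleftrightarrow>
     (\<forall>\<epsilon>>0. \<exists>\<delta>>0. \<forall>D. D division_of \<Union>D \<and> \<Union>D \<subseteq> {a..b} \<and> (\<Sum>k\<in>D. measure lborel k) < \<delta>
        \<longrightarrow> (\<Sum>k\<in>D. norm (\<omega> (Sup k) - \<omega> (Inf k))) < \<epsilon>)"

text \<open>A solution of the control system is a Caratheodory solution.  Absolute continuity cannot be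
  dropped: a Cantor function is continuous and satisfies \<open>\<omega>' = 0\<close> almost everywhere.
  Elements of \<open>L\<^sup>p\<close> are given by representatives; curves matter only on \<open>{0..T}\<close>.\<close>

definition Omega ::
  "real \<Rightarrow> (real^'n) set \<Rightarrow> real \<Rightarrow> (real^'d \<Rightarrow> real^'d) \<Rightarrow> ('n \<Rightarrow> real^'d \<Rightarrow> real^'d)
    \<Rightarrow> ((real \<Rightarrow> real^'d) \<times> (real \<Rightarrow> real^'n)) set" where
  "Omega T U p f0 f = {(\<omega>, u).
     continuous_on {0..T} \<omega> \<and> absolutely_continuous_on 0 T \<omega> \<and>
     u \<in> Lp_functions (lebesgue_on {0..T}) p \<and>
     (AE t in lebesgue_on {0..T}. u t \<in> U) \<and>
     (AE t in lebesgue_on {0..T}.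
        (\<omega> has_vector_derivative ctrl_field f0 f (\<omega> t) (u t)) (at t within {0..T}))}"

definition Omega_dist ::
  "real \<Rightarrow> real \<Rightarrow> (real \<Rightarrow> real^'d) \<times> (real \<Rightarrow> real^'n)
    \<Rightarrow> (real \<Rightarrow> real^'d) \<times> (real \<Rightarrow> real^'n) \<Rightarrow> real" where
  "Omega_dist T p a b =
     (SUP t\<in>{0..T}. norm (fst a t - fst b t)) +
     (\<integral>t. norm (snd a t - snd b t) powr p \<partial>lebesgue_on {0..T}) powr (1 / p)"

text \<open>The Borel \<open>\<sigma>\<close>-algebra of \<open>\<Omega>\<close> as a subspace of \<open>C([0,T]) \<times> L\<^sup>p(0,T)\<close>.
  As elements are representatives, \<^const>\<open>Omega_dist\<close> is only a pseudometric; its open sets, hence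
  the Borel sets, are exactly the preimages of those of the space of equivalence classes.\<close>

definition Omega_borel ::
  "real \<Rightarrow> (real^'n) set \<Rightarrow> real \<Rightarrow> (real^'d \<Rightarrow> real^'d) \<Rightarrow> ('n \<Rightarrow> real^'d \<Rightarrow> real^'d)
    \<Rightarrow> ((real \<Rightarrow> real^'d) \<times> (real \<Rightarrow> real^'n)) measure" where
  "Omega_borel T U p f0 f = sigma (Omega T U p f0 f)
     {W. W \<subseteq> Omega T U p f0 f \<and>
         (\<forall>a\<in>W. \<exists>\<epsilon>>0. \<forall>b\<in>Omega T U p f0 f. Omega_dist T p a b < \<epsilon> \<longrightarrow> b \<in> W)}"

section \<open>Evaluation of a measurable map into \<open>\<Omega>\<close>, and its cost\<close>

definition S_traj ::
  "('z \<Rightarrow> (real \<Rightarrow> real^'d) \<times> (real \<Rightarrow> real^'n)) \<Rightarrow> real \<Rightarrow> 'z \<Rightarrow> real^'d" where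
  "S_traj S t z = fst (S z) t"

text \<open>Point evaluation of the \<open>L\<^sup>p\<close> class \<open>snd (S z)\<close> is meaningful only through a representative
  that is measurable jointly in \<open>(t, z)\<close>.  If \<open>S\<close> is measurable into \<^const>\<open>Omega_borel\<close>, such a
  representative exists and is unique up to null sets of \<open>dt \<otimes> \<gamma>\<close>, so the cost below does not
  depend on the choice.\<close>

definition S_ctrl ::
  "real \<Rightarrow> 'z::topological_space measure \<Rightarrow> ('z \<Rightarrow> (real \<Rightarrow> real^'d) \<times> (real \<Rightarrow> real^'n))
    \<Rightarrow> real \<Rightarrow> 'z \<Rightarrow> real^'n" where
  "S_ctrl T \<gamma> S = (SOME v.
     (\<lambda>(t, z). v t z) \<in> borel_measurable borel \<and>
     (AE z in \<gamma>. AE t in lebesgue_on {0..T}. v t z = snd (S z) t))"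

text \<open>Integral with values in the extended reals.  Since \<open>\<infinity> - \<infinity> = \<infinity>\<close> in \<^typ>\<open>ereal\<close>, the integral
  is \<open>< \<infinity>\<close> iff it exists in the extended sense and is not \<open>\<infinity>\<close>.\<close>

definition eintegral :: "'a measure \<Rightarrow> ('a \<Rightarrow> ereal) \<Rightarrow> ereal" where
  "eintegral M g = enn2ereal (\<integral>\<^sup>+x. e2ennreal (g x) \<partial>M) - enn2ereal (\<integral>\<^sup>+x. e2ennreal (- g x) \<partial>M)"

definition total_cost ::
  "real \<Rightarrow> (real \<Rightarrow> real^'d \<Rightarrow> real^'n \<Rightarrow> real) \<Rightarrow> 'z::topological_space measure
    \<Rightarrow> ('z \<Rightarrow> (real \<Rightarrow> real^'d) \<times> (real \<Rightarrow> real^'n)) \<Rightarrow> ereal" where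
  "total_cost T L \<gamma> S =
     eintegral (lebesgue_on {0..T})
       (\<lambda>t. eintegral \<gamma> (\<lambda>z. ereal (L t (S_traj S t z) (S_ctrl T \<gamma> S t z))))"

section \<open>Couplings and the continuity equation\<close>

definition couplings :: "(real^'d) measure \<Rightarrow> (real^'d) measure \<Rightarrow> ((real^'d) \<times> (real^'d)) measure set" where
  "couplings \<mu>0 \<mu>T =
     {\<gamma> \<in> space (prob_algebra borel). distr \<gamma> borel fst = \<mu>0 \<and> distr \<gamma> borel snd = \<mu>T}"

definition narrowly_continuous_on :: "real set \<Rightarrow> (real \<Rightarrow> (real^'d) measure) \<Rightarrow> bool" where
  "narrowly_continuous_on I \<mu> \<longleftrightarrow>
     (\<forall>g :: real^'d \<Rightarrow> real. continuous_on UNIV g \<and> bounded (range g)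
        \<longrightarrow> continuous_on I (\<lambda>t. \<integral>x. g x \<partial>\<mu> t))"

text \<open>\<open>\<phi> \<in> C\<^sup>1\<^sub>c([0,T] \<times> \<real>\<^sup>d)\<close> with partial derivatives \<open>\<phi>t\<close> and \<open>\<phi>x\<close>, one-sided in time at \<open>0\<close> and \<open>T\<close>;
  \<open>\<phi>\<close> need not vanish at these times.\<close>

definition C1c_test ::
  "real \<Rightarrow> (real \<times> (real^'d) \<Rightarrow> real) \<Rightarrow> (real \<times> (real^'d) \<Rightarrow> real) \<Rightarrow> (real \<times> (real^'d) \<Rightarrow> real^'d)
    \<Rightarrow> bool" where
  "C1c_test T \<phi> \<phi>t \<phi>x \<longleftrightarrow>
     (\<forall>q\<in>{0..T} \<times> UNIV.
        (\<phi> has_derivative (\<lambda>(s, y). s * \<phi>t q + \<phi>x q \<bullet> y)) (at q within {0..T} \<times> UNIV)) \<and>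
     continuous_on ({0..T} \<times> UNIV) \<phi>t \<and> continuous_on ({0..T} \<times> UNIV) \<phi>x \<and>
     (\<exists>K. compact K \<and> (\<forall>q\<in>{0..T} \<times> UNIV - K. \<phi> q = 0))"

text \<open>The two integrability clauses say that the iterated integral exists; without them the equation
  would be about the default value \<open>0\<close> of the Bochner integral.\<close>

definition solves_continuity_equation ::
  "real \<Rightarrow> (real^'n) set \<Rightarrow> (real^'d \<Rightarrow> real^'d) \<Rightarrow> ('n \<Rightarrow> real^'d \<Rightarrow> real^'d)
    \<Rightarrow> (real \<Rightarrow> (real^'d) measure) \<Rightarrow> (real \<Rightarrow> real^'d \<Rightarrow> real^'n) \<Rightarrow> bool" where
  "solves_continuity_equation T U f0 f \<mu> u \<longleftrightarrow>
     (\<lambda>(t, x). u t x) \<in> borel_measurable (restrict_space borel ({0..T} \<times> UNIV)) \<and>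
     (\<forall>t\<in>{0..T}. \<forall>x. u t x \<in> U) \<and>
     (\<forall>t\<in>{0..T}. \<mu> t \<in> space (prob_algebra borel)) \<and>
     narrowly_continuous_on {0..T} \<mu> \<and>
     (\<forall>\<phi> \<phi>t \<phi>x. C1c_test T \<phi> \<phi>t \<phi>x \<longrightarrow>
        (let h = (\<lambda>t x. \<phi>t (t, x) + \<phi>x (t, x) \<bullet> ctrl_field f0 f x (u t x)) in
          (AE t in lebesgue_on {0..T}. integrable (\<mu> t) (h t)) \<and>
          integrable (lebesgue_on {0..T}) (\<lambda>t. \<integral>x. h t x \<partial>\<mu> t) \<and>
          (\<integral>t. (\<integral>x. h t x \<partial>\<mu> t) \<partial>lebesgue_on {0..T})
            = (\<integral>x. \<phi> (T, x) \<partial>\<mu> T) - (\<integral>x. \<phi> (0, x) \<partial>\<mu> 0)))"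

end

theory Submission
  imports Defs
begin

text \<open>Let \<open>\<mu> t\<close> be the image of \<open>\<gamma>\<close> under evaluation of the trajectories at time \<open>t\<close>, and let \<open>u(t, x)\<close>
  be the conditional mean of the controls of all trajectories that pass through \<open>x\<close> at time \<open>t\<close>.
  The field \<open>f(x, u)\<close> is affine in \<open>u\<close>, so integrating the chain rule for \<open>\<phi>(t, \<omega>(t))\<close> over all
  trajectories and conditioning on \<open>(t, \<omega>(t))\<close> gives the continuity equation. Conditional means of a
  variable with values in a closed convex set stay in that set: for \<open>U\<close> this shows that \<open>u\<close> is
  admissible, for the epigraph of \<open>|v|\<^sup>p\<close> it gives \<open>u(t, \<cdot>) \<in> L\<^sup>p(\<mu> t)\<close>, since finite cost
  and coercivity (or compactness of \<open>U\<close>) make \<open>|w|\<^sup>p\<close> integrable along the trajectories.\<close>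

section \<open>Integration\<close>

text \<open>Conditioning is done once, on space-time. Let \<open>m\<close> be the product of
  Lebesgue measure on \<open>{0..T}\<close> and \<open>\<gamma>\<close>, and \<open>M\<close> its
  image under the map from \<open>(t, z)\<close> to \<open>(t, X t z)\<close>; the conditional mean
  is then a Borel function on space-time. This makes \<open>u\<close> jointly measurable, which
  separate choices at each time would not give by themselves. Two obstacles shape the rest. An
  element of \<open>L^p\<close> has no point values, so a jointly measurable representative of the
  controls is built from their primitives, which depend continuously on the element of
  \<open>\<Omega>\<close>. And the fields may grow linearly; but test functions have compact
  support, so the coefficients \<open>\<phi>x \<bullet> f i\<close> are bounded, and integrability
  of the control justifies Fubini and conditioning. Taking the mean of the pair of \<open>w\<close>
  and \<open>|w|^p\<close>, with values in a single epigraph over \<open>U\<close>, yields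
  admissibility and the \<open>L^p\<close> bound at once.\<close>

lemma borel_measurable_pair_continuous:
  fixes X :: "real \<Rightarrow> 'z \<Rightarrow> 'b::{metric_space, second_countable_topology}"
  assumes meas: "\<And>t. X t \<in> borel_measurable N"
    and cont: "\<And>z. z \<in> space N \<Longrightarrow> continuous_on UNIV (\<lambda>t. X t z)"
  shows "(\<lambda>(t, z). X t z) \<in> borel_measurable (borel \<Otimes>\<^sub>M N)"
proof (rule borel_measurable_LIMSEQ_metric)
  \<comment> \<open>Rounding \<open>t\<close> down to multiples of \<open>1 / Suc n\<close> leaves
    countably many time slices, each measurable in \<open>z\<close>; continuity in time recovers
    \<open>X\<close> in the limit.\<close>
  let ?r = "\<lambda>n (t::real). real_of_int \<lfloor>real (Suc n) * t\<rfloor> / real (Suc n)"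
  show "(\<lambda>(t, z). X (?r n t) z) \<in> borel_measurable (borel \<Otimes>\<^sub>M N)" for n
  proof -
    have "(\<lambda>q. (\<lambda>i q. X (real_of_int i / real (Suc n)) (snd q)) \<lfloor>real (Suc n) * fst q\<rfloor> q)
        \<in> borel_measurable (borel \<Otimes>\<^sub>M N)"
      by (rule measurable_compose_countable) (use meas in measurable)
    then show ?thesis by (simp add: case_prod_beta')
  qed
  fix q :: "real \<times> 'z" assume "q \<in> space (borel \<Otimes>\<^sub>M N)"
  then obtain t z where q: "q = (t, z)" "z \<in> space N" by (auto simp: space_pair_measure)
  have "(\<lambda>n. ?r n t) \<longlonglongrightarrow> t"
  proof (rule LIMSEQ_I)
    fix e :: real assume "e > 0"
    then obtain m where m: "inverse (real (Suc m)) < e" using reals_Archimedean by blast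
    have "norm (?r n t - t) < e" if "n \<ge> m" for n
    proof -
      have "norm (?r n t - t) = \<bar>real_of_int \<lfloor>real (Suc n) * t\<rfloor> - real (Suc n) * t\<bar> / real (Suc n)"
        by (simp add: field_simps abs_divide del: of_nat_Suc)
      also have "\<dots> \<le> 1 / real (Suc n)"
        by (rule divide_right_mono) linarith+
      also have "\<dots> \<le> inverse (real (Suc m))"
        using that by (simp add: field_simps)
      finally show ?thesis using m by linarith
    qed
    then show "\<exists>m. \<forall>n\<ge>m. norm (?r n t - t) < e" by blast
  qed
  then have "(\<lambda>n. X (?r n t) z) \<longlonglongrightarrow> X t z"
    by (rule continuous_on_tendsto_compose[OF cont[OF q(2)]]) auto
  then show "(\<lambda>n. (case q of (t, z) \<Rightarrow> X (?r n t) z)) \<longlonglongrightarrow> (case q of (t, z) \<Rightarrow> X t z)"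
    by (simp add: q)
qed

text \<open>One \<open>c\<close> is lost by truncating \<open>h - c\<close> at \<open>0\<close>, the other by the negative part of \<open>g\<close>.\<close>

lemma eintegral_lower_bound:
  fixes h :: "'a \<Rightarrow> ennreal" and c :: real
  assumes "finite_measure M" and [measurable]: "h \<in> borel_measurable M" and "0 \<le> c"
    and bound: "AE x in M. enn2ereal (h x) - ereal c \<le> g x"
  shows "enn2ereal (\<integral>\<^sup>+x. h x \<partial>M) - ereal (2 * c * measure M (space M)) \<le> eintegral M g"
proof -
  interpret finite_measure M by fact
  define K where "K = c * measure M (space M)"
  have K: "K \<ge> 0" "ennreal c * emeasure M (space M) = ennreal K"
    using \<open>0 \<le> c\<close> by (auto simp: K_def emeasure_eq_measure ennreal_mult)
  have pos: "h x \<le> e2ennreal (g x) + ennreal c" and neg: "e2ennreal (- g x) \<le> ennreal c"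
    if "enn2ereal (h x) - ereal c \<le> g x" for x
  proof -
    show "h x \<le> e2ennreal (g x) + ennreal c"
    proof (cases "g x \<ge> 0")
      case True
      have "enn2ereal (h x) \<le> g x + ereal c"
        using that by (cases "enn2ereal (h x)"; cases "g x") auto
      also have "\<dots> = enn2ereal (e2ennreal (g x) + ennreal c)"
        using True \<open>0 \<le> c\<close> by (simp add: plus_ennreal.rep_eq enn2ereal_e2ennreal)
      finally show ?thesis by (simp add: less_eq_ennreal.rep_eq)
    next
      case False
      then have "enn2ereal (h x) \<le> ereal c"
        using that by (cases "enn2ereal (h x)"; cases "g x") auto
      also have "\<dots> = enn2ereal (ennreal c)" using \<open>0 \<le> c\<close> by simp
      finally show ?thesis 
        by (meson add_increasing less_eq_ennreal.rep_eq zero_le)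
    qed
    have "0 \<le> enn2ereal (h x)" by simp
    then have "- g x \<le> ereal c"
      using that by (cases "enn2ereal (h x)"; cases "g x") auto
    then have "e2ennreal (- g x) \<le> e2ennreal (ereal c)" by (rule e2ennreal_mono)
    then show "e2ennreal (- g x) \<le> ennreal c" by (simp add: ennreal_def)
  qed
  \<comment> \<open>\<open>g\<close> carries no measurability assumption: it enters only by
    monotonicity, while additivity is applied to \<open>h - c\<close>. Since \<open>B\<close> turns
    out finite, no \<open>\<infinity> - \<infinity>\<close> occurs in
    \<open>eintegral\<close>.\<close>
  define A where "A = (\<integral>\<^sup>+x. e2ennreal (g x) \<partial>M)"
  define B where "B = (\<integral>\<^sup>+x. e2ennreal (- g x) \<partial>M)"
  have "(\<integral>\<^sup>+x. h x \<partial>M) \<le> (\<integral>\<^sup>+x. (h x - ennreal c) + ennreal c \<partial>M)"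
  proof (rule nn_integral_mono)
    show "h x \<le> (h x - ennreal c) + ennreal c" for x
      by (cases "ennreal c \<le> h x") (auto simp: diff_add_cancel_ennreal add_increasing)
  qed
  also have "\<dots> = (\<integral>\<^sup>+x. h x - ennreal c \<partial>M) + ennreal K"
    by (subst nn_integral_add) (auto simp: K)
  also have "(\<integral>\<^sup>+x. h x - ennreal c \<partial>M) \<le> A"
    unfolding A_def
  proof (rule nn_integral_mono_AE)
    show "AE x in M. h x - ennreal c \<le> e2ennreal (g x)"
      using bound by eventually_elim (use pos in \<open>auto simp: ennreal_minus_le_iff add.commute\<close>)
  qed
  finally have 1: "(\<integral>\<^sup>+x. h x \<partial>M) \<le> A + ennreal K" by (simp add: add_right_mono)
  have "B \<le> (\<integral>\<^sup>+x. ennreal c \<partial>M)"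
    unfolding B_def using bound by (intro nn_integral_mono_AE) (auto elim!: eventually_mono dest: neg)
  then have 2: "B \<le> ennreal K" by (simp add: K)
  have "enn2ereal (\<integral>\<^sup>+x. h x \<partial>M) \<le> enn2ereal A + ereal K"
    using 1 K(1) by (simp add: less_eq_ennreal.rep_eq plus_ennreal.rep_eq)
  moreover have "enn2ereal B \<le> ereal K" "0 \<le> enn2ereal B"
    using 2 K(1) by (simp_all add: less_eq_ennreal.rep_eq)
  moreover have "0 \<le> enn2ereal A" by simp
  ultimately show ?thesis
    unfolding eintegral_def A_def[symmetric] B_def[symmetric]
    using K_def
    by (cases "enn2ereal A"; cases "enn2ereal B"; cases "enn2ereal (\<integral>\<^sup>+x. h x \<partial>M)") auto
qed

text \<open>In a tagged division, the intervals tagged outside the exceptional null set \<open>N\<close> are controlled by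
  the derivative; those tagged in \<open>N\<close> lie in an open set of small measure, so that absolute continuity
  bounds their total increment.\<close>

lemma absolutely_continuous_has_integral:
  fixes \<omega> :: "real \<Rightarrow> 'b::euclidean_space"
  assumes "a \<le> b" and ac: "absolutely_continuous_on a b \<omega>"
    and deriv: "AE t in lebesgue_on {a..b}. (\<omega> has_vector_derivative g t) (at t within {a..b})"
  shows "(g has_integral \<omega> b - \<omega> a) {a..b}"
proof -
  obtain N where N: "negligible N" "N \<subseteq> {a..b}"
    and dN: "\<And>t. t \<in> {a..b} - N \<Longrightarrow> (\<omega> has_vector_derivative g t) (at t within {a..b})"
  proof -
    have "AE t in lebesgue. t \<in> {a..b} \<longrightarrow> (\<omega> has_vector_derivative g t) (at t within {a..b})"
      using deriv by (subst (asm) AE_restrict_space_iff) auto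
    then have "negligible {t. \<not> (t \<in> {a..b} \<longrightarrow> (\<omega> has_vector_derivative g t) (at t within {a..b}))}"
      by (simp add: negligible_iff_null_sets completion.AE_iff_null_sets)
    then show thesis by (rule that) auto
  qed
  \<comment> \<open>Zeroing the derivative on \<open>N\<close> leaves the integral unchanged; a tag
    in \<open>N\<close> then contributes only the increment of \<open>\<omega>\<close> over its
    interval.\<close>
  define g' where "g' t = (if t \<in> N then 0 else g t)" for t
  have "(g' has_integral \<omega> b - \<omega> a) {a..b}"
  proof (cases "a = b")
    case True
    then show ?thesis using has_integral_refl(2)[of g' b] by simp
  next
    case False
    with \<open>a \<le> b\<close> have "a < b" by simp
    show ?thesis
      unfolding has_integral_factor_content_real
    proof (intro allI impI)
      fix e :: real assume "e > 0"
      \<comment> \<open>Half of the error is for the tags in \<open>N\<close>, half for the others: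
        each group contributes at most \<open>\<epsilon> * (b - a)\<close>.\<close>
      define \<epsilon> where "\<epsilon> = e / 2"
      have "\<epsilon> > 0" using \<open>e > 0\<close> by (simp add: \<epsilon>_def)
      have "\<epsilon> * (b - a) > 0" using \<open>\<epsilon> > 0\<close> \<open>a < b\<close> by simp
      then obtain \<delta> where "\<delta> > 0" and \<delta>: "\<And>D. \<lbrakk>D division_of \<Union>D; \<Union>D \<subseteq> {a..b};
          (\<Sum>k\<in>D. measure lborel k) < \<delta>\<rbrakk> \<Longrightarrow> (\<Sum>k\<in>D. norm (\<omega> (Sup k) - \<omega> (Inf k))) < \<epsilon> * (b - a)"
        using ac unfolding absolutely_continuous_on_def by meson
      obtain O' where O': "open O'" "N \<subseteq> O'" "O' \<in> lmeasurable" "measure lebesgue O' < \<delta>"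
      proof -
        have "N \<in> sets lebesgue" using N(1) by (simp add: negligible_iff_null_sets null_setsD2)
        then obtain O' where O': "open O'" "N \<subseteq> O'" "O' - N \<in> lmeasurable"
            "emeasure lebesgue (O' - N) < ennreal \<delta>"
          using sets_lebesgue_outer_open \<open>\<delta> > 0\<close> by metis
        have "O' = (O' - N) \<union> N" using O' by auto
        then have "O' \<in> lmeasurable"
          by (metis O'(3) N(1) fmeasurable.Un negligible_iff_measure)
        moreover have "measure lebesgue O' = measure lebesgue (O' - N)"
          using N(1) \<open>O' \<in> lmeasurable\<close>
          by (simp add: measure_Diff_null_set negligible_iff_null_sets)
        moreover have "measure lebesgue (O' - N) < \<delta>"
          using O'(3,4) \<open>\<delta> > 0\<close> by (simp add: emeasure_eq_measure2 ennreal_less_iff)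
        ultimately show thesis using that O' by simp
      qed
      have "\<exists>d>0. if t \<in> N then ball t d \<subseteq> O'
          else t \<in> {a..b} \<longrightarrow> (\<forall>s\<in>{a..b}. \<bar>s - t\<bar> < d \<longrightarrow>
            norm (\<omega> s - \<omega> t - (s - t) *\<^sub>R g t) \<le> \<epsilon> * \<bar>s - t\<bar>)" for t
      proof (cases "t \<in> N")
        case True
        then show ?thesis using O' open_contains_ball by auto
      next
        case False
        show ?thesis
        proof (cases "t \<in> {a..b}")
          case True
          with False dN have "(\<omega> has_derivative (\<lambda>x. x *\<^sub>R g t)) (at t within {a..b})"
            by (simp add: has_vector_derivative_def)
          then show ?thesis
            using \<open>\<epsilon> > 0\<close> False unfolding has_derivative_within_alt by (auto simp: real_norm_def)
        qed (use False in \<open>auto intro: exI[of _ 1]\<close>)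
      qed
      then obtain d where d: "\<And>t. d t > 0" "\<And>t. t \<in> N \<Longrightarrow> ball t (d t) \<subseteq> O'"
        "\<And>t s. \<lbrakk>t \<notin> N; t \<in> {a..b}; s \<in> {a..b}; \<bar>s - t\<bar> < d t\<rbrakk> \<Longrightarrow>
            norm (\<omega> s - \<omega> t - (s - t) *\<^sub>R g t) \<le> \<epsilon> * \<bar>s - t\<bar>"
        by metis
      define G where "G t = ball t (d t)" for t
      show "\<exists>G. gauge G \<and> (\<forall>p. p tagged_division_of {a..b} \<and> G fine p \<longrightarrow>
          norm ((\<Sum>(x, k)\<in>p. measure lborel k *\<^sub>R g' x) - (\<omega> b - \<omega> a)) \<le> e * measure lborel {a..b})"
      proof (intro exI conjI allI impI)
        show "gauge G" using d(1) by (auto simp: gauge_def G_def)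
        fix p assume "p tagged_division_of {a..b} \<and> G fine p"
        then have p: "p tagged_division_of {a..b}" and fine: "G fine p" by auto
        have "finite p" using p by auto
        have pk: "\<exists>u v. k = {u..v} \<and> u \<le> x \<and> x \<le> v \<and> a \<le> u \<and> v \<le> b \<and> {u..v} \<subseteq> G x"
          if xk: "(x, k) \<in> p" for x k
        proof -
          obtain u v where k: "k = {u..v}" using tagged_division_ofD(4)[OF p xk] by auto
          with tagged_division_ofD(2,3)[OF p xk] fineD[OF fine xk] show ?thesis
            by (intro exI[of _ u] exI[of _ v]) auto
        qed
        let ?F = "\<lambda>k. \<omega> (Sup k) - \<omega> (Inf k)"
        define p1 where "p1 = {(x, k)\<in>p. x \<in> N}"
        define p2 where "p2 = {(x, k)\<in>p. x \<notin> N}"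
        have p12: "p = p1 \<union> p2" "p1 \<inter> p2 = {}" "finite p1" "finite p2"
          using \<open>finite p\<close> by (auto simp: p1_def p2_def intro: finite_subset)
        have "(\<Sum>(x, k)\<in>p. measure lborel k *\<^sub>R g' x) - (\<omega> b - \<omega> a)
            = (\<Sum>(x, k)\<in>p. measure lborel k *\<^sub>R g' x - ?F k)"
          using additive_tagged_division_1[OF \<open>a \<le> b\<close> p, of \<omega>]
          by (simp add: sum_subtractf case_prod_beta')
        also have "norm \<dots> \<le> (\<Sum>(x, k)\<in>p. norm (measure lborel k *\<^sub>R g' x - ?F k))"
          by (simp add: case_prod_beta' sum_norm_le)
        also have "\<dots> = (\<Sum>(x, k)\<in>p1. norm (measure lborel k *\<^sub>R g' x - ?F k))
            + (\<Sum>(x, k)\<in>p2. norm (measure lborel k *\<^sub>R g' x - ?F k))"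
          using p12 by (simp add: sum.union_disjoint)
        also have "(\<Sum>(x, k)\<in>p1. norm (measure lborel k *\<^sub>R g' x - ?F k)) = (\<Sum>(x, k)\<in>p1. norm (?F k))"
          by (rule sum.cong) (auto simp: p1_def g'_def norm_minus_commute)
        also have "\<dots> \<le> \<epsilon> * (b - a)"
        proof -
          let ?D = "snd ` p1"
          have "p1 tagged_partial_division_of {a..b}"
            using p by (auto simp: p1_def tagged_division_of_def intro: tagged_partial_division_subset)
          then have tp1: "p1 tagged_division_of \<Union>?D" by (rule tagged_partial_division_of_Union_self)
          then have div: "?D division_of \<Union>?D" by (rule division_of_tagged_division)
          \<comment> \<open>Distinct tags can share an interval only if it is degenerate, and there
            the increment is 0; so the sum over tagged pairs becomes one over intervals. The guard
            is for the empty set, on which \<open>Sup\<close> and \<open>Inf\<close> say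
            nothing.\<close>
          have "(\<Sum>(x, k)\<in>p1. norm (?F k)) = (\<Sum>(x, k)\<in>p1. if k = {} then 0 else norm (?F k))"
            using pk by (intro sum.cong) (fastforce simp: p1_def)+
          also have "\<dots> = (\<Sum>k\<in>?D. if k = {} then 0 else norm (?F k))"
          proof (rule sum.over_tagged_division_lemma[OF tp1])
            fix u v :: real assume "box u v = {}"
            then show "(if cbox u v = {} then 0 else norm (?F (cbox u v))) = 0"
              by (cases u v rule: linorder_cases) auto
          qed
          also have "\<dots> \<le> (\<Sum>k\<in>?D. norm (?F k))" by (rule sum_mono) auto
          also have "\<dots> \<le> \<epsilon> * (b - a)"
          proof (rule less_imp_le, rule \<delta>[OF div])
            show "\<Union>?D \<subseteq> {a..b}" using pk by (fastforce simp: p1_def)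
            have "(\<Sum>k\<in>?D. measure lborel k) = (\<Sum>k\<in>?D. measure lebesgue k)"
              using pk by (intro sum.cong) (fastforce simp: p1_def)+
            also have "\<dots> = measure lebesgue (\<Union>?D)" by (rule content_division[OF div])
            also have "\<dots> \<le> measure lebesgue O'"
            proof (rule measure_mono_fmeasurable)
              show "\<Union>?D \<subseteq> O'" using pk d(2) by (fastforce simp: p1_def G_def)
              show "\<Union>?D \<in> sets lebesgue" using lmeasurable_division[OF div] by auto
            qed (use O' in auto)
            finally show "(\<Sum>k\<in>?D. measure lborel k) < \<delta>" using O' by simp
          qed
          finally show ?thesis .
        qed
        also have "(\<Sum>(x, k)\<in>p2. norm (measure lborel k *\<^sub>R g' x - ?F k)) \<le> (\<Sum>(x, k)\<in>p2. \<epsilon> * measure lborel k)"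
        proof (rule sum_mono, clarify)
          fix x k assume "(x, k) \<in> p2"
          then have xk: "(x, k) \<in> p" "x \<notin> N" by (auto simp: p2_def)
          then obtain u v where k: "k = {u..v}" "u \<le> x" "x \<le> v" "a \<le> u" "v \<le> b" "{u..v} \<subseteq> G x"
            using pk by meson
          then have "u \<in> G x" "v \<in> G x" by auto
          then have "norm (\<omega> u - \<omega> x - (u - x) *\<^sub>R g x) \<le> \<epsilon> * \<bar>u - x\<bar>"
            "norm (\<omega> v - \<omega> x - (v - x) *\<^sub>R g x) \<le> \<epsilon> * \<bar>v - x\<bar>"
            using k(2-5) d(3)[OF xk(2), of u] d(3)[OF xk(2), of v] by (auto simp: G_def dist_real_def)
          \<comment> \<open>Straddle argument: the tag lies between the endpoints, so the two
            one-sided errors add up to \<open>\<epsilon>\<close> times the length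
            \<open>v - u\<close>.\<close>
          then have "norm ((\<omega> u - \<omega> x - (u - x) *\<^sub>R g x) - (\<omega> v - \<omega> x - (v - x) *\<^sub>R g x))
              \<le> \<epsilon> * (x - u) + \<epsilon> * (v - x)"
            using k by (intro order_trans[OF norm_triangle_ineq4]) auto
          also have "\<dots> = \<epsilon> * measure lborel k" using k by (simp add: algebra_simps)
          also have "(\<omega> u - \<omega> x - (u - x) *\<^sub>R g x) - (\<omega> v - \<omega> x - (v - x) *\<^sub>R g x)
              = measure lborel k *\<^sub>R g' x - ?F k"
            using k xk by (simp add: g'_def algebra_simps)
          finally show "norm (measure lborel k *\<^sub>R g' x - ?F k) \<le> \<epsilon> * measure lborel k" .
        qed
        also have "\<dots> \<le> (\<Sum>(x, k)\<in>p. \<epsilon> * measure lborel k)"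
          using \<open>\<epsilon> > 0\<close> \<open>finite p\<close> by (intro sum_mono2) (auto simp: p2_def)
        also have "\<dots> = \<epsilon> * measure lborel {a..b}"
          using additive_content_tagged_division[of p a b] p
          by (simp add: sum_distrib_left[symmetric] case_prod_beta')
        also have "\<epsilon> * (b - a) + \<epsilon> * measure lborel {a..b} = e * measure lborel {a..b}"
          using \<open>a < b\<close> by (simp add: \<epsilon>_def algebra_simps)
        finally show "norm ((\<Sum>(x, k)\<in>p. measure lborel k *\<^sub>R g' x) - (\<omega> b - \<omega> a)) \<le> e * measure lborel {a..b}"
          by simp
      qed
    qed
  qed
  then show ?thesis
    by (rule has_integral_spike[OF N(1), rotated]) (auto simp: g'_def)
qed

section \<open>Conditional means\<close>

text \<open>\<open>g\<close> is the Radon-Nikodym density of the image of \<open>W\<close> times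
  \<open>M\<close> with respect to the image of \<open>M\<close>. The function \<open>h\<close> may
  be unbounded: changes of measure also hold for nonintegrable functions, both sides then being the
  default value 0.\<close>

lemma conditional_mean_nonneg:
  fixes W :: "'a \<Rightarrow> real"
  assumes [measurable]: "\<Phi> \<in> M \<rightarrow>\<^sub>M N"
    and fin: "finite_measure M" and W: "integrable M W" "\<And>x. W x \<ge> 0"
  obtains g where "g \<in> borel_measurable N" "integrable (distr M N \<Phi>) g"
    "\<And>h::'c \<Rightarrow> real. h \<in> borel_measurable N \<Longrightarrow>
      (\<integral>x. h (\<Phi> x) * W x \<partial>M) = (\<integral>y. h y * g y \<partial>distr M N \<Phi>)"
proof -
  interpret finite_measure M by fact
  interpret \<mu>: finite_measure "distr M N \<Phi>" by (rule finite_measure_distr) fact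
  let ?\<mu> = "distr M N \<Phi>"
  have [measurable]: "W \<in> borel_measurable M" using W by simp
  define \<nu> where "\<nu> = distr (density M W) N \<Phi>"
  have "absolutely_continuous ?\<mu> \<nu>"
    unfolding absolutely_continuous_def
  proof
    fix A assume A: "A \<in> null_sets ?\<mu>"
    then have [measurable]: "A \<in> sets N" and "emeasure M (\<Phi> -` A \<inter> space M) = 0"
      by (auto simp: null_sets_def emeasure_distr)
    then have "\<Phi> -` A \<inter> space M \<in> null_sets M" by auto
    then have "AE x in M. \<Phi> x \<notin> A" by (auto dest!: AE_not_in elim!: eventually_mono[OF AE_conjI[OF AE_space]])
    then have "emeasure (density M W) (\<Phi> -` A \<inter> space M) = 0"
      by (subst emeasure_density) (auto simp: nn_integral_0_iff_AE elim!: eventually_mono)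
    then show "A \<in> null_sets \<nu>" by (auto simp: \<nu>_def null_sets_def emeasure_distr)
  qed
  then obtain r where r[measurable]: "r \<in> borel_measurable N" and eq: "density ?\<mu> r = \<nu>"
    using \<mu>.Radon_Nikodym[of \<nu>] by (auto simp: \<nu>_def)
  have "(\<integral>\<^sup>+y. r y \<partial>?\<mu>) = emeasure (density ?\<mu> r) (space ?\<mu>)"
    by (subst emeasure_density) (auto intro!: nn_integral_cong)
  also have "\<dots> = emeasure \<nu> (space \<nu>)" by (simp only: eq[symmetric] space_density)
  also have "\<dots> = (\<integral>\<^sup>+x. W x \<partial>M)"
    unfolding \<nu>_def
    by (simp add: emeasure_distr emeasure_density measurable_space cong: nn_integral_cong)
       (auto intro!: nn_integral_cong split: split_indicator dest: measurable_space[OF assms(1)])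
  also have "\<dots> < \<infinity>" using W by (subst nn_integral_eq_integral) auto
  finally have fin': "(\<integral>\<^sup>+y. r y \<partial>?\<mu>) < \<infinity>" .
  then have AEr: "AE y in ?\<mu>. r y = ennreal (enn2real (r y))"
    using nn_integral_noteq_infinite[of r ?\<mu>] by (auto simp: top.not_eq_extremum elim!: eventually_mono)
  \<comment> \<open>The density has finite integral, hence is finite almost everywhere, so a
    real-valued version represents it.\<close>
  define g where "g y = enn2real (r y)" for y
  have gm[measurable]: "g \<in> borel_measurable N" unfolding g_def by measurable
  show thesis
  proof (rule that)
    show "g \<in> borel_measurable N" by fact
    have "(\<integral>\<^sup>+y. ennreal (g y) \<partial>?\<mu>) = (\<integral>\<^sup>+y. r y \<partial>?\<mu>)"
      using AEr by (intro nn_integral_cong_AE) (auto simp: g_def)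
    then show "integrable ?\<mu> g"
      using fin' by (intro integrableI_nonneg) (auto simp: g_def)
    fix h :: "'c \<Rightarrow> real" assume [measurable]: "h \<in> borel_measurable N"
    have "(\<integral>x. h (\<Phi> x) * W x \<partial>M) = (\<integral>x. h (\<Phi> x) \<partial>density M W)"
      using W by (subst integral_density) (auto simp: mult.commute)
    also have "\<dots> = (\<integral>y. h y \<partial>\<nu>)" unfolding \<nu>_def by (subst integral_distr) auto
    also have "\<nu> = density ?\<mu> g"
      unfolding eq[symmetric] using AEr by (intro density_cong) (auto simp: g_def)
    also have "(\<integral>y. h y \<partial>density ?\<mu> g) = (\<integral>y. h y * g y \<partial>?\<mu>)"
      by (subst integral_density) (auto simp: mult.commute g_def)
    finally show "(\<integral>x. h (\<Phi> x) * W x \<partial>M) = (\<integral>y. h y * g y \<partial>?\<mu>)" .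
  qed
qed

lemma integrable_bounded_mult:
  fixes W :: "'a \<Rightarrow> 'b::{banach, second_countable_topology}"
  assumes "integrable M W" "h \<in> borel_measurable M" "\<And>x. x \<in> space M \<Longrightarrow> \<bar>h x\<bar> \<le> (C::real)"
  shows "integrable M (\<lambda>x. h x *\<^sub>R W x)"
proof (rule Bochner_Integration.integrable_bound)
  show "integrable M (\<lambda>x. C *\<^sub>R W x)" using assms by auto
  show "(\<lambda>x. h x *\<^sub>R W x) \<in> borel_measurable M" using assms by auto
  show "AE x in M. norm (h x *\<^sub>R W x) \<le> norm (C *\<^sub>R W x)"
    using assms(3) by (intro AE_I2) (auto intro!: mult_right_mono order_trans[OF assms(3) abs_ge_self])
qed

text \<open>Coordinates and then positive and negative parts reduce this to the nonnegative case.
  Boundedness of \<open>h\<close> keeps every term integrable, so that the pieces can be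
  recombined.\<close>

lemma conditional_mean:
  fixes W :: "'a \<Rightarrow> 'b::euclidean_space"
  assumes meas[measurable]: "\<Phi> \<in> M \<rightarrow>\<^sub>M N"
    and fin: "finite_measure M" and W: "integrable M W"
  obtains g where "g \<in> borel_measurable N" "integrable (distr M N \<Phi>) g"
    "\<And>(h::'c \<Rightarrow> real) C. \<lbrakk>h \<in> borel_measurable N; \<And>y. y \<in> space N \<Longrightarrow> \<bar>h y\<bar> \<le> C\<rbrakk> \<Longrightarrow>
      (\<integral>x. h (\<Phi> x) *\<^sub>R W x \<partial>M) = (\<integral>y. h y *\<^sub>R g y \<partial>distr M N \<Phi>)"
proof -
  let ?\<mu> = "distr M N \<Phi>"
  have [measurable]: "W \<in> borel_measurable M" using W by simp
  have real_case: "\<exists>g. g \<in> borel_measurable N \<and> integrable ?\<mu> g \<and>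
      (\<forall>(h::'c \<Rightarrow> real) C. h \<in> borel_measurable N \<longrightarrow> (\<forall>y\<in>space N. \<bar>h y\<bar> \<le> C) \<longrightarrow>
        (\<integral>x. h (\<Phi> x) * V x \<partial>M) = (\<integral>y. h y * g y \<partial>?\<mu>))"
    if V: "integrable M V" for V :: "'a \<Rightarrow> real"
  proof -
    have Vp: "integrable M (\<lambda>x. max 0 (V x))" "integrable M (\<lambda>x. max 0 (- V x))" using V by auto
    obtain g1 where g1: "g1 \<in> borel_measurable N" "integrable ?\<mu> g1"
      "\<And>h::'c \<Rightarrow> real. h \<in> borel_measurable N \<Longrightarrow>
        (\<integral>x. h (\<Phi> x) * max 0 (V x) \<partial>M) = (\<integral>y. h y * g1 y \<partial>?\<mu>)"
      using conditional_mean_nonneg[OF meas fin Vp(1)] by auto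
    obtain g2 where g2: "g2 \<in> borel_measurable N" "integrable ?\<mu> g2"
      "\<And>h::'c \<Rightarrow> real. h \<in> borel_measurable N \<Longrightarrow>
        (\<integral>x. h (\<Phi> x) * max 0 (- V x) \<partial>M) = (\<integral>y. h y * g2 y \<partial>?\<mu>)"
      using conditional_mean_nonneg[OF meas fin Vp(2)] by auto
    show ?thesis
    proof (intro exI conjI allI impI)
      show "(\<lambda>y. g1 y - g2 y) \<in> borel_measurable N" "integrable ?\<mu> (\<lambda>y. g1 y - g2 y)"
        using g1 g2 by auto
      fix h :: "'c \<Rightarrow> real" and C
      assume h[measurable]: "h \<in> borel_measurable N" and C: "\<forall>y\<in>space N. \<bar>h y\<bar> \<le> C"
      have i: "integrable ?\<mu> (\<lambda>y. h y * g y)" if "integrable ?\<mu> g" for g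
        using integrable_bounded_mult[OF that, of h C] C by auto
      have j: "integrable M (\<lambda>x. h (\<Phi> x) * g x)" if "integrable M g" for g
        using integrable_bounded_mult[OF that, of "\<lambda>x. h (\<Phi> x)" C] C
          measurable_space[OF meas] by auto
      have "(\<integral>x. h (\<Phi> x) * V x \<partial>M)
          = (\<integral>x. h (\<Phi> x) * max 0 (V x) - h (\<Phi> x) * max 0 (- V x) \<partial>M)"
        by (intro Bochner_Integration.integral_cong) (auto simp: max_def)
      also have "\<dots> = (\<integral>y. h y * g1 y \<partial>?\<mu>) - (\<integral>y. h y * g2 y \<partial>?\<mu>)"
        using g1(3)[OF h] g2(3)[OF h] j[OF Vp(1)] j[OF Vp(2)] by simp
      also have "\<dots> = (\<integral>y. h y * (g1 y - g2 y) \<partial>?\<mu>)"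
        using i[OF g1(2)] i[OF g2(2)] by (simp add: right_diff_distrib)
      finally show "(\<integral>x. h (\<Phi> x) * V x \<partial>M) = (\<integral>y. h y * (g1 y - g2 y) \<partial>?\<mu>)" .
    qed
  qed
  have "\<forall>b\<in>Basis. \<exists>g. g \<in> borel_measurable N \<and> integrable ?\<mu> g \<and>
      (\<forall>(h::'c \<Rightarrow> real) C. h \<in> borel_measurable N \<longrightarrow> (\<forall>y\<in>space N. \<bar>h y\<bar> \<le> C) \<longrightarrow>
        (\<integral>x. h (\<Phi> x) * (W x \<bullet> b) \<partial>M) = (\<integral>y. h y * g y \<partial>?\<mu>))"
    by (rule ballI, rule real_case, rule integrable_inner_left, rule W)
  from bchoice[OF this] obtain G where G: "\<forall>b\<in>Basis. G b \<in> borel_measurable N \<and> integrable ?\<mu> (G b) \<and>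
      (\<forall>(h::'c \<Rightarrow> real) C. h \<in> borel_measurable N \<longrightarrow> (\<forall>y\<in>space N. \<bar>h y\<bar> \<le> C) \<longrightarrow>
        (\<integral>x. h (\<Phi> x) * (W x \<bullet> b) \<partial>M) = (\<integral>y. h y * G b y \<partial>?\<mu>))" ..
  have Gm[measurable]: "G b \<in> borel_measurable N" and Gi: "integrable ?\<mu> (G b)" if "b \<in> Basis" for b
    using G that by auto
  define g where "g y = (\<Sum>b\<in>Basis. G b y *\<^sub>R b)" for y
  have gi: "integrable ?\<mu> g" unfolding g_def using Gi by auto
  show thesis
  proof (rule that)
    show "g \<in> borel_measurable N" unfolding g_def by measurable
    show "integrable ?\<mu> g" by fact
    fix h :: "'c \<Rightarrow> real" and C
    assume h[measurable]: "h \<in> borel_measurable N" and C: "\<And>y. y \<in> space N \<Longrightarrow> \<bar>h y\<bar> \<le> C"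
    have i: "integrable ?\<mu> (\<lambda>y. h y *\<^sub>R g y)"
      using integrable_bounded_mult[OF gi, of h C] C by auto
    have j: "integrable M (\<lambda>x. h (\<Phi> x) *\<^sub>R W x)"
      using integrable_bounded_mult[OF W, of "\<lambda>x. h (\<Phi> x)" C] C
        measurable_space[OF meas] by auto
    show "(\<integral>x. h (\<Phi> x) *\<^sub>R W x \<partial>M) = (\<integral>y. h y *\<^sub>R g y \<partial>?\<mu>)"
    proof (rule euclidean_eqI)
      fix b :: 'b assume b: "b \<in> Basis"
      have "(\<integral>x. h (\<Phi> x) *\<^sub>R W x \<partial>M) \<bullet> b = (\<integral>x. h (\<Phi> x) * (W x \<bullet> b) \<partial>M)"
        using integral_inner_left[of b M, OF j] by simp
      also have "\<dots> = (\<integral>y. h y * G b y \<partial>?\<mu>)" using G b h C by blast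
      also have "\<dots> = (\<integral>y. (h y *\<^sub>R g y) \<bullet> b \<partial>?\<mu>)"
        using b by (simp add: g_def)
      also have "\<dots> = (\<integral>y. h y *\<^sub>R g y \<partial>?\<mu>) \<bullet> b"
        using integral_inner_left[of b ?\<mu>, OF i] by simp
      finally show "(\<integral>x. h (\<Phi> x) *\<^sub>R W x \<partial>M) \<bullet> b = (\<integral>y. h y *\<^sub>R g y \<partial>?\<mu>) \<bullet> b" .
    qed
  qed
qed

text \<open>A closed convex set is a countable intersection of half-spaces, so one half-space at a time
  suffices.\<close>

lemma conditional_mean_in_closed_convex:
  fixes W :: "'a \<Rightarrow> 'b::euclidean_space" and \<Phi> :: "'a \<Rightarrow> 'c"
  assumes meas[measurable]: "\<Phi> \<in> M \<rightarrow>\<^sub>M N"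
    and fin: "finite_measure M" and W: "integrable M W"
    and gm[measurable]: "g \<in> borel_measurable N" and gi: "integrable (distr M N \<Phi>) g"
    and mean: "\<And>(h::'c \<Rightarrow> real) C. \<lbrakk>h \<in> borel_measurable N; \<And>y. y \<in> space N \<Longrightarrow> \<bar>h y\<bar> \<le> C\<rbrakk> \<Longrightarrow>
      (\<integral>x. h (\<Phi> x) *\<^sub>R W x \<partial>M) = (\<integral>y. h y *\<^sub>R g y \<partial>distr M N \<Phi>)"
    and K: "closed K" "convex K" and WK: "AE x in M. W x \<in> K"
  shows "AE y in distr M N \<Phi>. g y \<in> K"
proof -
  interpret finite_measure M by fact
  interpret \<mu>: finite_measure "distr M N \<Phi>" by (rule finite_measure_distr) fact
  let ?\<mu> = "distr M N \<Phi>"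
  define \<H> where "\<H> = {{v. a \<bullet> v < b} |a b. \<forall>v\<in>K. a \<bullet> v > b}"
  have cover: "\<Union>\<H> = - K"
  proof
    show "- K \<subseteq> \<Union>\<H>"
    proof
      fix z assume "z \<in> - K"
      then obtain a b where "a \<bullet> z < b" "\<forall>v\<in>K. a \<bullet> v > b"
        using separating_hyperplane_closed_point[OF K(2,1), of z] by auto
      then show "z \<in> \<Union>\<H>" unfolding \<H>_def by blast
    qed
    show "\<Union>\<H> \<subseteq> - K" unfolding \<H>_def by (clarsimp simp: not_less) (meson less_asym)
  qed
  have "open H" if "H \<in> \<H>" for H using that by (auto simp: \<H>_def open_halfspace_lt)
  then obtain \<H>' where \<H>': "\<H>' \<subseteq> \<H>" "countable \<H>'" "\<Union>\<H>' = \<Union>\<H>" using Lindelof by metis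
  have "AE y in ?\<mu>. g y \<notin> H" if H: "H \<in> \<H>" for H
  proof -
    obtain a b where H_eq: "H = {v. a \<bullet> v < b}" and ab: "\<forall>v\<in>K. a \<bullet> v > b"
      using H by (auto simp: \<H>_def)
    \<comment> \<open>Test with the indicator of the event \<open>a \<bullet> g y < b\<close>. In
      direction \<open>a\<close>, \<open>W\<close> averages to at least \<open>b\<close> over that
      event, while \<open>g\<close> stays below \<open>b\<close>; equality of the two averages
      forces the event to be null.\<close>
    define h :: "'c \<Rightarrow> real" where "h y = (if a \<bullet> g y < b then 1 else 0)" for y
    have hm[measurable]: "h \<in> borel_measurable N" unfolding h_def by measurable
    have hb: "\<bar>h y\<bar> \<le> 1" for y by (simp add: h_def)
    have i: "integrable ?\<mu> (\<lambda>y. h y *\<^sub>R g y)" "integrable ?\<mu> h"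
      using integrable_bounded_mult[OF gi, of h 1] hb
      by (auto intro!: \<mu>.integrable_const_bound[where B=1])
    have j: "integrable M (\<lambda>x. h (\<Phi> x) *\<^sub>R W x)" "integrable M (\<lambda>x. h (\<Phi> x))"
      using integrable_bounded_mult[OF W, of "\<lambda>x. h (\<Phi> x)" 1] hb
      by (auto intro!: integrable_const_bound[where B=1])
    have "0 \<le> (\<integral>x. a \<bullet> (h (\<Phi> x) *\<^sub>R W x) - b * h (\<Phi> x) \<partial>M)"
      using WK ab by (intro integral_nonneg_AE) (auto elim!: eventually_mono simp: h_def less_imp_le)
    also have "\<dots> = a \<bullet> (\<integral>x. h (\<Phi> x) *\<^sub>R W x \<partial>M) - b * (\<integral>x. h (\<Phi> x) \<partial>M)"
      using j integral_inner_right[of a M, OF j(1)] integrable_inner_right[OF j(1), of a]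
      by (subst Bochner_Integration.integral_diff) auto
    also have "\<dots> = a \<bullet> (\<integral>y. h y *\<^sub>R g y \<partial>?\<mu>) - b * (\<integral>y. h y \<partial>?\<mu>)"
      using mean[OF hm, of 1] hb by (simp add: integral_distr)
    also have "\<dots> = (\<integral>y. a \<bullet> (h y *\<^sub>R g y) - b * h y \<partial>?\<mu>)"
      using i integral_inner_right[of a ?\<mu>, OF i(1)] integrable_inner_right[OF i(1), of a]
      by (subst Bochner_Integration.integral_diff) auto
    finally have ge: "0 \<le> (\<integral>y. a \<bullet> (h y *\<^sub>R g y) - b * h y \<partial>?\<mu>)" .
    have nonneg: "0 \<le> b * h y - a \<bullet> (h y *\<^sub>R g y)" for y by (auto simp: h_def)
    have int: "integrable ?\<mu> (\<lambda>y. b * h y - a \<bullet> (h y *\<^sub>R g y))"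
      using i integrable_inner_right[OF i(1), of a] by auto
    have "(\<integral>y. b * h y - a \<bullet> (h y *\<^sub>R g y) \<partial>?\<mu>) = - (\<integral>y. a \<bullet> (h y *\<^sub>R g y) - b * h y \<partial>?\<mu>)"
      by (subst Bochner_Integration.integral_minus[symmetric]) simp
    then have "(\<integral>y. b * h y - a \<bullet> (h y *\<^sub>R g y) \<partial>?\<mu>) = 0"
      using ge Bochner_Integration.integral_nonneg[of ?\<mu> "\<lambda>y. b * h y - a \<bullet> (h y *\<^sub>R g y)", OF nonneg]
      by linarith
    then have "AE y in ?\<mu>. b * h y - a \<bullet> (h y *\<^sub>R g y) = 0"
      using integral_nonneg_eq_0_iff_AE[OF int] nonneg by auto
    then show ?thesis by eventually_elim (auto simp: H_eq h_def)
  qed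
  then have "AE y in ?\<mu>. \<forall>H\<in>\<H>'. g y \<notin> H"
    using \<H>' by (subst AE_ball_countable) auto
  then show ?thesis
  proof (rule eventually_mono)
    fix y assume "\<forall>H\<in>\<H>'. g y \<notin> H"
    then have "g y \<notin> \<Union>\<H>'" by simp
    then show "g y \<in> K" using \<H>'(3) cover by simp
  qed
qed

section \<open>Measurable families of trajectories\<close>

text \<open>Integrated over a finite measure, this says that a small \<open>L\<^sup>p\<close> distance forces a small \<open>L\<^sup>1\<close>
  distance, without Hoelder.\<close>

lemma le_add_powr:
  fixes s \<eta> p :: real
  assumes "s \<ge> 0" "\<eta> > 0" "p \<ge> 1"
  shows "s \<le> \<eta> + \<eta> powr (1 - p) * s powr p"
proof (cases "s \<le> \<eta>")
  case False
  then have "s > 0" using assms by simp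
  then have "s = s powr (1 - p) * s powr p" by (simp add: powr_add[symmetric])
  also have "\<dots> \<le> \<eta> powr (1 - p) * s powr p"
    using False assms by (intro mult_right_mono powr_mono2') auto
  finally show ?thesis using assms by simp
qed (use assms in \<open>auto intro: add_increasing2\<close>)

lemma Lp_functions_integrable:
  fixes g :: "'a \<Rightarrow> 'b::euclidean_space"
  assumes "finite_measure M" "p \<ge> 1" "g \<in> Lp_functions M p"
  shows "integrable M g"
proof (rule Bochner_Integration.integrable_bound)
  interpret finite_measure M by fact
  show "integrable M (\<lambda>x. 1 + norm (g x) powr p)" using assms by (auto simp: Lp_functions_def)
  show "g \<in> borel_measurable M" using assms by (auto simp: Lp_functions_def)
  show "AE x in M. norm (g x) \<le> norm (1 + norm (g x) powr p)"
    using le_add_powr[of "norm (g _)" 1 p] \<open>p \<ge> 1\<close> by (intro AE_I2) simp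
qed

lemma Lp_functions_diff:
  fixes g h :: "'a \<Rightarrow> 'b::euclidean_space"
  assumes "p \<ge> 1" "g \<in> Lp_functions M p" "h \<in> Lp_functions M p"
  shows "(\<lambda>x. g x - h x) \<in> Lp_functions M p"
proof -
  have [measurable]: "g \<in> borel_measurable M" "h \<in> borel_measurable M"
    using assms by (auto simp: Lp_functions_def)
  have "integrable M (\<lambda>x. norm (g x - h x) powr p)"
  proof (rule Bochner_Integration.integrable_bound)
    show "integrable M (\<lambda>x. 2 powr p * (norm (g x) powr p + norm (h x) powr p))"
      using assms by (auto simp: Lp_functions_def)
    show "AE x in M. norm (norm (g x - h x) powr p)
        \<le> norm (2 powr p * (norm (g x) powr p + norm (h x) powr p))"
    proof (intro AE_I2)
      fix x
      have "norm (g x - h x) \<le> 2 * max (norm (g x)) (norm (h x))"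
        using norm_triangle_ineq4[of "g x" "h x"] by simp
      then have "norm (g x - h x) powr p \<le> (2 * max (norm (g x)) (norm (h x))) powr p"
        using \<open>p \<ge> 1\<close> by (intro powr_mono2) auto
      also have "\<dots> = 2 powr p * max (norm (g x)) (norm (h x)) powr p"
        by (simp add: powr_mult)
      also have "\<dots> \<le> 2 powr p * (norm (g x) powr p + norm (h x) powr p)"
        by (intro mult_left_mono) (auto simp: max_def)
      finally show "norm (norm (g x - h x) powr p)
          \<le> norm (2 powr p * (norm (g x) powr p + norm (h x) powr p))"
        by (simp add: abs_of_nonneg)
    qed
  qed measurable
  then show ?thesis by (simp add: Lp_functions_def)
qed

lemma finite_measure_lebesgue_on_Icc: "finite_measure (lebesgue_on {a..b::real})"
  by (rule finite_measureI) (simp add: emeasure_restrict_space emeasure_lborel_Icc_eq)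

context
  fixes T p :: real and U :: "(real^'n) set"
    and f0 :: "real^'d \<Rightarrow> real^'d" and f :: "'n \<Rightarrow> real^'d \<Rightarrow> real^'d"
  assumes T: "T > 0" and p: "p \<ge> 1"
begin

lemma Omega_control_integrable:
  assumes "a \<in> Omega T U p f0 f"
  shows "integrable (lebesgue_on {0..T}) (snd a)" "snd a integrable_on {0..T}"
proof -
  show *: "integrable (lebesgue_on {0..T}) (snd a)"
    using assms by (intro Lp_functions_integrable[OF finite_measure_lebesgue_on_Icc p])
      (auto simp: Omega_def)
  show "snd a integrable_on {0..T}" by (rule integrable_on_lebesgue_on[OF *]) simp
qed

lemma Omega_dist_bounds:
  assumes a: "a \<in> Omega T U p f0 f" and b: "b \<in> Omega T U p f0 f"
  shows "t \<in> {0..T} \<Longrightarrow> norm (fst a t - fst b t) \<le> Omega_dist T p a b"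
    and "(\<integral>t. norm (snd a t - snd b t) powr p \<partial>lebesgue_on {0..T}) \<le> Omega_dist T p a b powr p"
proof -
  let ?I = "\<integral>t. norm (snd a t - snd b t) powr p \<partial>lebesgue_on {0..T}"
  \<comment> \<open>A real \<open>SUP\<close> bounds its elements only when the set is bounded
    above; continuity on the compact interval provides that.\<close>
  have "continuous_on {0..T} (\<lambda>t. norm (fst a t - fst b t))"
    using a b by (auto simp: Omega_def intro!: continuous_intros)
  then have "bdd_above ((\<lambda>t. norm (fst a t - fst b t)) ` {0..T})"
    by (intro bounded_imp_bdd_above compact_imp_bounded compact_continuous_image) auto
  then have sup: "norm (fst a t - fst b t) \<le> (SUP t\<in>{0..T}. norm (fst a t - fst b t))"
    if "t \<in> {0..T}" for t
    using that by (intro cSUP_upper)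
  show "t \<in> {0..T} \<Longrightarrow> norm (fst a t - fst b t) \<le> Omega_dist T p a b"
    using sup[of t] unfolding Omega_dist_def by (simp add: add_increasing2)
  have "0 \<le> (SUP t\<in>{0..T}. norm (fst a t - fst b t))"
    using order_trans[OF norm_ge_zero sup[of 0]] T by simp
  then have "?I powr (1 / p) \<le> Omega_dist T p a b" unfolding Omega_dist_def by simp
  then have "(?I powr (1 / p)) powr p \<le> Omega_dist T p a b powr p"
    using p by (intro powr_mono2) auto
  moreover have "0 \<le> ?I" by simp
  ultimately show "?I \<le> Omega_dist T p a b powr p" using p by (simp add: powr_powr)
qed

text \<open>Continuity for the pseudometric is enough: the preimage of an open set is then itself a
  generator of \<open>Omega_borel\<close>.\<close>

lemma Omega_borel_measurableI:
  fixes F :: "_ \<Rightarrow> 'b::metric_space"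
  assumes "\<And>a e. \<lbrakk>a \<in> Omega T U p f0 f; e > 0\<rbrakk>
    \<Longrightarrow> \<exists>\<delta>>0. \<forall>b\<in>Omega T U p f0 f. Omega_dist T p a b < \<delta> \<longrightarrow> dist (F b) (F a) < e"
  shows "F \<in> borel_measurable (Omega_borel T U p f0 f)"
proof (rule borel_measurableI)
  fix W :: "'b set" assume "open W"
  have "\<exists>\<epsilon>>0. \<forall>b\<in>Omega T U p f0 f. Omega_dist T p a b < \<epsilon> \<longrightarrow> F b \<in> W" if a: "a \<in> Omega T U p f0 f" "F a \<in> W" for a
  proof -
    obtain e where "e > 0" "\<And>y. dist y (F a) < e \<Longrightarrow> y \<in> W"
      using \<open>open W\<close> a(2) by (auto simp: open_dist)
    then show ?thesis using assms[OF a(1)] by meson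
  qed
  then show "F -` W \<inter> space (Omega_borel T U p f0 f) \<in> sets (Omega_borel T U p f0 f)"
    unfolding Omega_borel_def by (subst sets_measure_of) (auto simp: space_measure_of_conv)
qed

lemma Omega_eval_measurable:
  assumes "t \<in> {0..T}"
  shows "(\<lambda>a. fst a t) \<in> borel_measurable (Omega_borel T U p f0 f)"
proof (rule Omega_borel_measurableI)
  fix a :: "(real \<Rightarrow> real^'d) \<times> (real \<Rightarrow> real^'n)" and e :: real assume "a \<in> Omega T U p f0 f" "e > 0"
  then show "\<exists>\<delta>>0. \<forall>b\<in>Omega T U p f0 f. Omega_dist T p a b < \<delta> \<longrightarrow> dist (fst b t) (fst a t) < e"
    using Omega_dist_bounds(1)[OF \<open>a \<in> Omega T U p f0 f\<close> _ assms]
    by (intro exI[of _ e]) (force simp: dist_norm norm_minus_commute intro: le_less_trans)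
qed

text \<open>Integrals over \<open>{0..t}\<close> depend only on the class of the control, unlike its
  value at a point, and vary continuously with it. They are the way to a measurable
  representative.\<close>

lemma Omega_primitive_measurable:
  assumes t: "t \<in> {0..T}"
  shows "(\<lambda>a. integral {0..t} (snd a)) \<in> borel_measurable (Omega_borel T U p f0 f)"
proof (rule Omega_borel_measurableI)
  fix a :: "(real \<Rightarrow> real^'d) \<times> (real \<Rightarrow> real^'n)" and e :: real assume a: "a \<in> Omega T U p f0 f" and e: "e > 0"
  \<comment> \<open>The constants make \<open>\<eta> * T\<close> and
    \<open>\<eta> powr (1 - p) * \<delta> powr p\<close> both equal to \<open>e / 2\<close>.\<close>
  define \<eta> where "\<eta> = e / (2 * T)"
  have \<eta>: "\<eta> > 0" using e T by (simp add: \<eta>_def)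
  define \<delta> where "\<delta> = (e / (2 * \<eta> powr (1 - p))) powr (1 / p)"
  have "\<delta> > 0" using e \<eta> by (simp add: \<delta>_def)
  moreover have "dist (integral {0..t} (snd b)) (integral {0..t} (snd a)) < e"
    if b: "b \<in> Omega T U p f0 f" and ab: "Omega_dist T p a b < \<delta>" for b
  proof -
    interpret finite_measure "lebesgue_on {0..T}" by (rule finite_measure_lebesgue_on_Icc)
    let ?d = "\<lambda>t. snd b t - snd a t"
    have Lp: "?d \<in> Lp_functions (lebesgue_on {0..T}) p"
      using a b p by (auto simp: Omega_def intro: Lp_functions_diff)
    have i: "integrable (lebesgue_on {0..T}) ?d" 
      by (rule Lp_functions_integrable[OF finite_measure_lebesgue_on_Icc p Lp])
    then have it: "integrable (lebesgue_on {0..t}) ?d"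
      using t by (intro integrable_subinterval[OF i]) auto
    have "integral {0..t} (snd b) - integral {0..t} (snd a) = integral {0..t} ?d"
      using Omega_control_integrable(2)[OF a] Omega_control_integrable(2)[OF b] t
      by (subst Henstock_Kurzweil_Integration.integral_diff)
         (auto intro: integrable_on_subinterval)
    also have "\<dots> = (\<integral>s. ?d s \<partial>lebesgue_on {0..t})"
      using it by (subst lebesgue_integral_eq_integral) auto
    also have "norm \<dots> \<le> (\<integral>s. norm (?d s) \<partial>lebesgue_on {0..t})"
      by (rule integral_norm_bound)
    also have "\<dots> \<le> (\<integral>s. norm (?d s) \<partial>lebesgue_on {0..T})"
      using i it t by (subst (1 2) lebesgue_integral_eq_integral)
        (auto intro!: integral_subset_le integrable_on_lebesgue_on)
    also have "\<dots> \<le> (\<integral>s. \<eta> + \<eta> powr (1 - p) * norm (?d s) powr p \<partial>lebesgue_on {0..T})"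
      using i Lp \<eta> p by (intro integral_mono) (auto simp: Lp_functions_def intro: le_add_powr)
    also have "\<dots> = \<eta> * T + \<eta> powr (1 - p) * (\<integral>s. norm (?d s) powr p \<partial>lebesgue_on {0..T})"
      using Lp T by (subst Bochner_Integration.integral_add)
        (auto simp: Lp_functions_def measure_restrict_space)
    also have "(\<integral>s. norm (?d s) powr p \<partial>lebesgue_on {0..T}) \<le> Omega_dist T p a b powr p"
      using Omega_dist_bounds(2)[OF a b] by (simp add: norm_minus_commute)
    also have "Omega_dist T p a b powr p < \<delta> powr p"
      using ab p Omega_dist_bounds(1)[OF a b, of 0] T
      by (intro powr_less_mono2) (auto intro: order_trans[OF norm_ge_zero])
    also have "\<delta> powr p = e / (2 * \<eta> powr (1 - p))" using e \<eta> p by (simp add: \<delta>_def powr_powr)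
    also have "\<eta> * T + \<eta> powr (1 - p) * \<dots> = e"
      using T \<eta> by (simp add: \<eta>_def field_simps)
    finally show ?thesis using \<eta> by (simp add: dist_norm)
  qed
  ultimately show "\<exists>\<delta>>0. \<forall>b\<in>Omega T U p f0 f. Omega_dist T p a b < \<delta>
      \<longrightarrow> dist (integral {0..t} (snd b)) (integral {0..t} (snd a)) < e" by blast
qed

text \<open>Curves matter on \<open>{0..T}\<close> only; freezing them at the endpoints gives
  functions continuous on the whole line, as \<open>borel_measurable_pair_continuous\<close>
  demands.\<close>

lemma continuous_on_clamp:
  fixes h :: "real \<Rightarrow> 'b::topological_space"
  assumes "continuous_on {0..T} h"
  shows "continuous_on UNIV (\<lambda>t. h (max 0 (min T t)))"
  using T by (intro continuous_on_compose2[OF assms] continuous_intros) auto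

lemma Omega_trajectory_jointly_measurable:
  assumes S: "S \<in> N \<rightarrow>\<^sub>M Omega_borel T U p f0 f"
  shows "(\<lambda>(t, z). fst (S z) (max 0 (min T t))) \<in> borel_measurable (borel \<Otimes>\<^sub>M N)"
proof (rule borel_measurable_pair_continuous)
  show "(\<lambda>z. fst (S z) (max 0 (min T t))) \<in> borel_measurable N" for t
    using T by (intro measurable_compose[OF S Omega_eval_measurable]) auto
  fix z assume "z \<in> space N"
  then have "S z \<in> Omega T U p f0 f" using measurable_space[OF S] by (simp add: Omega_borel_def space_measure_of_conv)
  then show "continuous_on UNIV (\<lambda>t. fst (S z) (max 0 (min T t)))"
    by (intro continuous_on_clamp) (auto simp: Omega_def)
qed

text \<open>By Lebesgue's differentiation theorem the difference quotients of the primitive of a control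
  converge to it almost everywhere; where they diverge, \<^const>\<open>lim\<close> has an arbitrary value, which
  does no harm.\<close>

lemma Omega_control_jointly_measurable:
  assumes S: "S \<in> N \<rightarrow>\<^sub>M Omega_borel T U p f0 f"
  obtains v where "(\<lambda>(t, z). v t z) \<in> borel_measurable (borel \<Otimes>\<^sub>M N)"
    "\<And>z. z \<in> space N \<Longrightarrow> AE t in lebesgue_on {0..T}. v t z = snd (S z) t"
proof -
  define G where "G t z = integral {0..max 0 (min T t)} (snd (S z))" for t z
  define v where "v t z = lim (\<lambda>n. real (Suc n) *\<^sub>R (G (t + 1 / real (Suc n)) z - G t z))" for t z
  have S_Omega: "S z \<in> Omega T U p f0 f" if "z \<in> space N" for z
    using measurable_space[OF S that] by (simp add: Omega_borel_def space_measure_of_conv)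
  have Gm[measurable]: "(\<lambda>(t, z). G t z) \<in> borel_measurable (borel \<Otimes>\<^sub>M N)"
  proof (rule borel_measurable_pair_continuous)
    show "G t \<in> borel_measurable N" for t
      unfolding G_def using T by (intro measurable_compose[OF S Omega_primitive_measurable]) auto
    show "continuous_on UNIV (\<lambda>t. G t z)" if "z \<in> space N" for z
      unfolding G_def using Omega_control_integrable(2)[OF S_Omega[OF that]]
      by (intro continuous_on_clamp indefinite_integral_continuous_1)
  qed
  show thesis
  proof (rule that)
    have "(\<lambda>q. lim (\<lambda>n. real (Suc n) *\<^sub>R (G (fst q + 1 / real (Suc n)) (snd q) - G (fst q) (snd q))))
        \<in> borel_measurable (borel \<Otimes>\<^sub>M N)"
    proof (rule borel_measurable_lim_metric)
      fix n
      have "(\<lambda>q. (\<lambda>(t, z). G t z) (fst q + 1 / real (Suc n), snd q)) \<in> borel_measurable (borel \<Otimes>\<^sub>M N)"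
        "(\<lambda>q. (\<lambda>(t, z). G t z) (fst q, snd q)) \<in> borel_measurable (borel \<Otimes>\<^sub>M N)"
        by measurable
      then show "(\<lambda>q. real (Suc n) *\<^sub>R (G (fst q + 1 / real (Suc n)) (snd q) - G (fst q) (snd q)))
          \<in> borel_measurable (borel \<Otimes>\<^sub>M N)" by simp
    qed
    then show "(\<lambda>(t, z). v t z) \<in> borel_measurable (borel \<Otimes>\<^sub>M N)"
      by (simp add: v_def case_prod_beta')
    fix z assume z: "z \<in> space N"
    \<comment> \<open>Extension by 0 makes the control integrable on every box, as the
      differentiation theorem wants.\<close>
    let ?u = "snd (S z)" and ?w = "\<lambda>t. if t \<in> {0..T} then snd (S z) t else 0"
    have u: "?u integrable_on {0..T}" by (rule Omega_control_integrable(2)[OF S_Omega[OF z]])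
    then have "?w integrable_on UNIV" by (simp only: integrable_restrict_UNIV)
    then have "?w integrable_on cbox a b" for a b by (rule integrable_on_subcbox) auto
    then obtain E where E: "negligible E" and
      lim: "\<And>t e. \<lbrakk>t \<notin> E; 0 < e\<rbrakk> \<Longrightarrow> \<exists>d>0. \<forall>h. 0 < h \<and> h < d \<longrightarrow>
         norm (integral (cbox t (t + h *\<^sub>R One)) ?w /\<^sub>R h ^ DIM(real) - ?w t) < e"
      using integrable_ccontinuous_explicit by blast
    have eq: "v t z = ?u t" if t: "t \<in> {0..<T}" "t \<notin> E" for t
    proof -
      have "(\<lambda>n. real (Suc n) *\<^sub>R (G (t + 1 / real (Suc n)) z - G t z)) \<longlonglongrightarrow> ?u t"
      proof (rule LIMSEQ_I)
        fix e :: real assume "e > 0"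
        obtain d where "d > 0" and d: "\<And>h. 0 < h \<and> h < d \<Longrightarrow>
            norm (integral {t..t + h} ?w /\<^sub>R h - ?w t) < e"
          using lim[OF t(2) \<open>e > 0\<close>] by auto
        \<comment> \<open>The bound \<open>T - t\<close> keeps \<open>t + h\<close> inside the
          interval, where the clamp in \<open>G\<close> has no effect. At \<open>t = T\<close> there
          is no such room, so \<open>T\<close> is added to the null set below.\<close>
        define d' where "d' = min d (T - t)"
        have "d' > 0" using \<open>d > 0\<close> t by (simp add: d'_def)
        then obtain m where m: "inverse (real (Suc m)) < d'" using reals_Archimedean by blast
        have "norm (real (Suc n) *\<^sub>R (G (t + 1 / real (Suc n)) z - G t z) - ?u t) < e"
          if "n \<ge> m" for n
        proof -
          define h where "h = 1 / real (Suc n)"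
          have "h > 0" by (simp add: h_def)
          have "h \<le> inverse (real (Suc m))" using that by (simp add: h_def field_simps)
          then have h: "h < d" "t + h < T" using m by (auto simp: d'_def)
          have "integral {0..t} ?u + integral {t..t + h} ?u = integral {0..t + h} ?u"
            using t h \<open>h > 0\<close> by (intro Henstock_Kurzweil_Integration.integral_combine
              integrable_on_subinterval[OF u]) auto
          then have "G (t + h) z - G t z = integral {t..t + h} ?u"
            using t h \<open>h > 0\<close> by (simp add: G_def algebra_simps)
          also have "\<dots> = integral {t..t + h} ?w"
            using t h by (intro Henstock_Kurzweil_Integration.integral_cong) auto
          finally have "real (Suc n) *\<^sub>R (G (t + h) z - G t z) = integral {t..t + h} ?w /\<^sub>R h"
            by (simp add: h_def)
          then show ?thesis using d[of h] h \<open>h > 0\<close> t by (simp add: h_def)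
        qed
        then show "\<exists>m. \<forall>n\<ge>m. norm (real (Suc n) *\<^sub>R (G (t + 1 / real (Suc n)) z - G t z) - ?u t) < e"
          by blast
      qed
      then show ?thesis unfolding v_def by (rule limI)
    qed
    have "negligible (insert T E)" using E by simp
    then have "AE t in lebesgue. t \<notin> insert T E"
      by (simp only: negligible_iff_null_sets AE_not_in)
    then have "AE t in lebesgue. t \<in> {0..T} \<longrightarrow> v t z = ?u t"
      by eventually_elim (use eq in force)
    then show "AE t in lebesgue_on {0..T}. v t z = ?u t"
      by (subst AE_restrict_space_iff) auto
  qed
qed

end

section \<open>Test functions along curves\<close>

text \<open>Serves twice: for \<open>\<phi>\<close> along a curve, where the increments of the graph
  of \<open>\<omega>\<close> control those of \<open>\<phi>\<close>, and with \<open>B = 1\<close>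
  for a curve that agrees with \<open>\<omega>\<close> on the interval.\<close>

lemma absolutely_continuous_on_graph:
  fixes \<omega> :: "real \<Rightarrow> 'b::real_normed_vector" and \<psi> :: "real \<Rightarrow> 'c::real_normed_vector"
  assumes ac: "absolutely_continuous_on a b \<omega>" and "B \<ge> 0"
    and lip: "\<And>s t. \<lbrakk>s \<in> {a..b}; t \<in> {a..b}\<rbrakk>
      \<Longrightarrow> norm (\<psi> s - \<psi> t) \<le> B * (\<bar>s - t\<bar> + norm (\<omega> s - \<omega> t))"
  shows "absolutely_continuous_on a b \<psi>"
  unfolding absolutely_continuous_on_def
proof (intro allI impI)
  fix \<epsilon> :: real assume "\<epsilon> > 0"
  \<comment> \<open>One \<open>\<eta>\<close> is spent on the total length, one on the increments of
    \<open>\<omega>\<close>; \<open>B + 1\<close> instead of \<open>B\<close> allows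
    \<open>B = 0\<close> and makes the bound strict.\<close>
  define \<eta> where "\<eta> = \<epsilon> / (2 * (B + 1))"
  have \<eta>: "\<eta> > 0" using \<open>\<epsilon> > 0\<close> \<open>B \<ge> 0\<close> by (simp add: \<eta>_def)
  then obtain \<delta> where "\<delta> > 0" and \<delta>: "\<And>D. \<lbrakk>D division_of \<Union>D; \<Union>D \<subseteq> {a..b};
      (\<Sum>k\<in>D. measure lborel k) < \<delta>\<rbrakk> \<Longrightarrow> (\<Sum>k\<in>D. norm (\<omega> (Sup k) - \<omega> (Inf k))) < \<eta>"
    using ac unfolding absolutely_continuous_on_def by meson
  show "\<exists>\<delta>>0. \<forall>D. D division_of \<Union>D \<and> \<Union>D \<subseteq> {a..b} \<and> (\<Sum>k\<in>D. measure lborel k) < \<delta>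
      \<longrightarrow> (\<Sum>k\<in>D. norm (\<psi> (Sup k) - \<psi> (Inf k))) < \<epsilon>"
  proof (intro exI[of _ "min \<delta> \<eta>"] conjI allI impI)
    show "min \<delta> \<eta> > 0" using \<open>\<delta> > 0\<close> \<eta> by simp
    fix D assume D: "D division_of \<Union>D \<and> \<Union>D \<subseteq> {a..b} \<and> (\<Sum>k\<in>D. measure lborel k) < min \<delta> \<eta>"
    have "(\<Sum>k\<in>D. norm (\<psi> (Sup k) - \<psi> (Inf k)))
        \<le> (\<Sum>k\<in>D. B * (measure lborel k + norm (\<omega> (Sup k) - \<omega> (Inf k))))"
    proof (rule sum_mono)
      fix k assume k: "k \<in> D"
      then obtain u v where uv: "k = {u..v}" "u \<le> v"
        using division_ofD(3,4)[of D "\<Union>D" k] D by auto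
      then have "u \<in> {a..b}" "v \<in> {a..b}" using k D by fastforce+
      then show "norm (\<psi> (Sup k) - \<psi> (Inf k)) \<le> B * (measure lborel k + norm (\<omega> (Sup k) - \<omega> (Inf k)))"
        using lip[of v u] uv by simp
    qed
    also have "\<dots> = B * ((\<Sum>k\<in>D. measure lborel k) + (\<Sum>k\<in>D. norm (\<omega> (Sup k) - \<omega> (Inf k))))"
      by (simp add: sum_distrib_left[symmetric] sum.distrib)
    also have "\<dots> \<le> B * (\<eta> + \<eta>)"
      using D \<delta>[of D] \<open>B \<ge> 0\<close> by (intro mult_left_mono add_mono) auto
    also have "\<dots> < (B + 1) * (2 * \<eta>)" using \<eta> by (simp add: algebra_simps)
    also have "\<dots> = \<epsilon>" using \<open>B \<ge> 0\<close> by (auto simp: \<eta>_def divide_simps algebra_simps)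
    finally show "(\<Sum>k\<in>D. norm (\<psi> (Sup k) - \<psi> (Inf k))) < \<epsilon>" .
  qed
qed

text \<open>The test condition only makes \<open>\<phi>\<close> itself vanish off \<open>K\<close>.
  As \<open>K\<close> is closed, \<open>\<phi>\<close> is locally zero on the slab near such a
  point, and uniqueness of the derivative transfers this to \<open>\<phi>t\<close> and
  \<open>\<phi>x\<close>.\<close>

lemma C1c_test_derivative_zero:
  fixes \<phi> :: "real \<times> (real^'d) \<Rightarrow> real"
  assumes "T > 0" and \<phi>: "C1c_test T \<phi> \<phi>t \<phi>x" and "compact K"
    and K: "\<forall>q\<in>{0..T} \<times> UNIV - K. \<phi> q = 0"
    and q: "q \<in> {0..T} \<times> UNIV" "q \<notin> K"
  shows "\<phi>t q = 0" "\<phi>x q = 0"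
proof -
  let ?S = "{0..T} \<times> (UNIV :: (real^'d) set)"
  have "open (- K)" using \<open>compact K\<close> by (simp add: compact_imp_closed open_Compl)
  have d0: "(\<phi> has_derivative (\<lambda>_. 0)) (at q within ?S)"
  proof -
    obtain d where "d > 0" "ball q d \<subseteq> - K" using \<open>open (- K)\<close> q(2) open_contains_ball by blast
    then show ?thesis
      using q K by (intro has_derivative_transform_within[of "\<lambda>_. 0" "\<lambda>_. 0" q ?S d \<phi>])
        (auto simp: subset_iff dist_commute)
  qed
  have "(\<lambda>(s, y). s * \<phi>t q + \<phi>x q \<bullet> y) = (\<lambda>_. 0)"
  proof (rule frechet_derivative_unique_within[OF _ d0])
    show "(\<phi> has_derivative (\<lambda>(s, y). s * \<phi>t q + \<phi>x q \<bullet> y)) (at q within ?S)"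
      using \<phi> q by (auto simp: C1c_test_def)
    fix i :: "real \<times> (real^'d)" and e :: real assume i: "i \<in> Basis" and "e > 0"
    obtain t x where tx: "q = (t, x)" "0 \<le> t" "t \<le> T" using q by auto
    consider "i = (1, 0)" | b where "i = (0, b)" using i by (auto simp: Basis_prod_def)
    \<comment> \<open>Uniqueness within the slab needs arbitrarily short steps along every basis
      vector that stay inside; in time the step goes forward before \<open>T\<close> and backward at
      \<open>T\<close>.\<close>
    then show "\<exists>d. 0 < \<bar>d\<bar> \<and> \<bar>d\<bar> < e \<and> q + d *\<^sub>R i \<in> ?S"
    proof cases
      case 1
      show ?thesis
      proof (cases "t < T")
        case True
        with 1 tx \<open>e > 0\<close> show ?thesis
          by (intro exI[of _ "min (e / 2) (T - t)"]) auto
      next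
        case False
        with 1 tx \<open>e > 0\<close> \<open>T > 0\<close> show ?thesis
          by (intro exI[of _ "- min (e / 2) T"]) auto
      qed
    next
      case 2
      with tx \<open>e > 0\<close> show ?thesis by (intro exI[of _ "e / 2"]) auto
    qed
  qed
  then have *: "s * \<phi>t q + \<phi>x q \<bullet> y = 0" for s y by (simp add: fun_eq_iff)
  show "\<phi>t q = 0" using *[of 1 0] by simp
  show "\<phi>x q = 0" using *[of 0 "\<phi>x q"] by simp
qed

text \<open>All bounds come from compactness of the slab intersected with \<open>K\<close>. The
  radius \<open>R\<close> matters later: beyond it \<open>\<phi>x\<close> vanishes, which tames
  fields of linear growth.\<close>

lemma C1c_test_bounds:
  fixes \<phi> :: "real \<times> (real^'d) \<Rightarrow> real"
  assumes "T > 0" and \<phi>: "C1c_test T \<phi> \<phi>t \<phi>x"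
  obtains C R where "C \<ge> 0" "R \<ge> 0"
    "\<And>q. q \<in> {0..T} \<times> UNIV \<Longrightarrow> \<bar>\<phi> q\<bar> \<le> C \<and> \<bar>\<phi>t q\<bar> \<le> C \<and> norm (\<phi>x q) \<le> C"
    "\<And>q. \<lbrakk>q \<in> {0..T} \<times> UNIV; norm (snd q) > R\<rbrakk> \<Longrightarrow> \<phi>x q = 0"
    "continuous_on ({0..T} \<times> UNIV) \<phi>"
proof -
  let ?S = "{0..T} \<times> (UNIV :: (real^'d) set)"
  obtain K where K: "compact K" "\<forall>q\<in>?S - K. \<phi> q = 0" using \<phi> by (auto simp: C1c_test_def)
  have c: "continuous_on ?S \<phi>"
    by (rule has_derivative_continuous_on[where f' = "\<lambda>q (s, y). s * \<phi>t q + \<phi>x q \<bullet> y"])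
      (use \<phi> in \<open>auto simp: C1c_test_def\<close>)
  have SK: "compact (?S \<inter> K)" using K by (intro closed_Int_compact closed_Times) auto
  have bnd: "\<exists>B\<ge>0. \<forall>q\<in>?S \<inter> K. norm (h q) \<le> B" if "continuous_on ?S h"
    for h :: "_ \<Rightarrow> 'e::real_normed_vector"
  proof -
    have "bounded (h ` (?S \<inter> K))"
      using that SK by (intro compact_imp_bounded compact_continuous_image) (auto intro: continuous_on_subset)
    then obtain B where "B > 0" "\<forall>q\<in>?S \<inter> K. norm (h q) \<le> B" unfolding bounded_pos by blast
    then show ?thesis by (intro exI[of _ B]) auto
  qed
  obtain B1 where B1: "B1 \<ge> 0" "\<forall>q\<in>?S \<inter> K. norm (\<phi> q) \<le> B1" using bnd[OF c] by blast
  obtain B2 where B2: "B2 \<ge> 0" "\<forall>q\<in>?S \<inter> K. norm (\<phi>t q) \<le> B2"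
    using bnd[of \<phi>t] \<phi> by (auto simp: C1c_test_def)
  obtain B3 where B3: "B3 \<ge> 0" "\<forall>q\<in>?S \<inter> K. norm (\<phi>x q) \<le> B3"
    using bnd[of \<phi>x] \<phi> by (auto simp: C1c_test_def)
  obtain R where R: "R > 0" "\<forall>q\<in>K. norm q \<le> R"
    using compact_imp_bounded[OF K(1)] unfolding bounded_pos by blast
  note zero = C1c_test_derivative_zero[OF assms K]
  show thesis
  proof (rule that)
    show "B1 + B2 + B3 \<ge> 0" "R \<ge> 0" using B1 B2 B3 R by auto
    show "continuous_on ?S \<phi>" by fact
    show "\<bar>\<phi> q\<bar> \<le> B1 + B2 + B3 \<and> \<bar>\<phi>t q\<bar> \<le> B1 + B2 + B3 \<and> norm (\<phi>x q) \<le> B1 + B2 + B3"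
      if q: "q \<in> ?S" for q
    proof (cases "q \<in> K")
      case True
      then have "norm (\<phi> q) \<le> B1" "norm (\<phi>t q) \<le> B2" "norm (\<phi>x q) \<le> B3"
        using B1 B2 B3 q by auto
      then show ?thesis using B1 B2 B3 by auto
    next
      case False
      then show ?thesis using zero[OF q False] K(2) q B1 B2 B3 by auto
    qed
    show "\<phi>x q = 0" if "q \<in> ?S" "norm (snd q) > R" for q
    proof -
      have "norm (snd q) \<le> norm q" using norm_snd_le[of "snd q" "fst q"] by simp
      then have "q \<notin> K" using R that(2) by force
      then show ?thesis using zero(2) that by blast
    qed
  qed
qed

text \<open>Bounded derivatives on the convex slab make \<open>\<phi>\<close> Lipschitz, so
  \<open>\<phi> (t, \<omega> t)\<close> is absolutely continuous and the fundamental theorem applies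
  to its chain-rule derivative, which exists almost everywhere.\<close>

lemma C1c_test_along_curve:
  fixes \<phi> :: "real \<times> (real^'d) \<Rightarrow> real"
  assumes "T > 0" and \<phi>: "C1c_test T \<phi> \<phi>t \<phi>x" and ac: "absolutely_continuous_on 0 T \<omega>"
    and deriv: "AE t in lebesgue_on {0..T}. (\<omega> has_vector_derivative F t) (at t within {0..T})"
  shows "((\<lambda>t. \<phi>t (t, \<omega> t) + \<phi>x (t, \<omega> t) \<bullet> F t) has_integral \<phi> (T, \<omega> T) - \<phi> (0, \<omega> 0)) {0..T}"
proof -
  let ?S = "{0..T} \<times> (UNIV :: (real^'d) set)"
  have d\<phi>: "(\<phi> has_derivative (\<lambda>(s, y). s * \<phi>t q + \<phi>x q \<bullet> y)) (at q within ?S)" if "q \<in> ?S" for q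
    using \<phi> that by (auto simp: C1c_test_def)
  obtain C R where C: "C \<ge> 0"
    "\<And>q. q \<in> ?S \<Longrightarrow> \<bar>\<phi> q\<bar> \<le> C \<and> \<bar>\<phi>t q\<bar> \<le> C \<and> norm (\<phi>x q) \<le> C"
    using C1c_test_bounds[OF assms(1,2)] by metis
  have lip: "norm (\<phi> q - \<phi> r) \<le> (2 * C) * norm (q - r)" if "q \<in> ?S" "r \<in> ?S" for q r
  proof (rule differentiable_bound[where S = ?S and f' = "\<lambda>q (s, y). s * \<phi>t q + \<phi>x q \<bullet> y"])
    show "(\<phi> has_derivative (\<lambda>(s, y). s * \<phi>t q + \<phi>x q \<bullet> y)) (at q within ?S)" if "q \<in> ?S" for q
      by (rule d\<phi>[OF that])
    show "convex ?S" by (intro convex_Times) auto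
    show "onorm (\<lambda>(s, y). s * \<phi>t q + \<phi>x q \<bullet> y) \<le> 2 * C" if "q \<in> ?S" for q
    proof (rule onorm_bound)
      show "0 \<le> 2 * C" using C by simp
      fix v :: "real \<times> (real^'d)"
      obtain s y where v: "v = (s, y)" by (cases v)
      have "norm (s * \<phi>t q + \<phi>x q \<bullet> y) \<le> \<bar>s\<bar> * \<bar>\<phi>t q\<bar> + norm (\<phi>x q) * norm y"
        using Cauchy_Schwarz_ineq2[of "\<phi>x q" y] by (simp add: abs_mult[symmetric] abs_triangle_ineq[THEN order_trans])
      also have "\<dots> \<le> norm v * C + C * norm v"
        using C that norm_fst_le[of s y] norm_snd_le[of y s] v
        by (intro add_mono mult_mono) auto
      finally show "norm (case v of (s, y) \<Rightarrow> s * \<phi>t q + \<phi>x q \<bullet> y) \<le> 2 * C * norm v"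
        by (simp add: v)
    qed
  qed (use that in auto)
  have "((\<lambda>t. \<phi>t (t, \<omega> t) + \<phi>x (t, \<omega> t) \<bullet> F t) has_integral
      (\<lambda>t. \<phi> (t, \<omega> t)) T - (\<lambda>t. \<phi> (t, \<omega> t)) 0) {0..T}"
  proof (rule absolutely_continuous_has_integral)
    show "absolutely_continuous_on 0 T (\<lambda>t. \<phi> (t, \<omega> t))"
    proof (rule absolutely_continuous_on_graph[OF ac])
      show "0 \<le> 2 * C" using C by simp
      fix s t assume st: "s \<in> {0..T}" "t \<in> {0..T}"
      have "norm (\<phi> (s, \<omega> s) - \<phi> (t, \<omega> t)) \<le> 2 * C * norm ((s, \<omega> s) - (t, \<omega> t))"
        using st by (intro lip) auto
      also have "\<dots> \<le> 2 * C * (\<bar>s - t\<bar> + norm (\<omega> s - \<omega> t))"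
        using C norm_Pair_le[of "s - t" "\<omega> s - \<omega> t"] by (intro mult_left_mono) auto
      finally show "norm (\<phi> (s, \<omega> s) - \<phi> (t, \<omega> t)) \<le> 2 * C * (\<bar>s - t\<bar> + norm (\<omega> s - \<omega> t))" .
    qed
    have "AE t in lebesgue_on {0..T}. t \<in> {0..T}" by (rule AE_I2) simp
    then show "AE t in lebesgue_on {0..T}. ((\<lambda>t. \<phi> (t, \<omega> t)) has_vector_derivative
        \<phi>t (t, \<omega> t) + \<phi>x (t, \<omega> t) \<bullet> F t) (at t within {0..T})"
      using deriv
    proof eventually_elim
      case (elim t)
      then have "((\<lambda>t. (t, \<omega> t)) has_derivative (\<lambda>s. (s, s *\<^sub>R F t))) (at t within {0..T})"
        by (auto simp: has_vector_derivative_def intro: has_derivative_Pair has_derivative_ident)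
      from has_derivative_in_compose2[OF d\<phi> _ elim(1) this]
      show ?case
        by (auto simp: has_vector_derivative_def distrib_left image_subset_iff)
    qed
  qed (use \<open>T > 0\<close> in auto)
  then show ?thesis by simp
qed

section \<open>The continuity equation\<close>

lemma convex_on_norm_powr:
  fixes p :: real
  assumes p: "p \<ge> 1"
  shows "convex_on UNIV (\<lambda>v::'b::real_normed_vector. norm v powr p)"
proof (rule convex_onI)
  fix t :: real and x y :: 'b assume t: "0 < t" "t < 1"
  have aux: "((1 - t) * a + t * b) powr p \<le> (1 - t) * a powr p + t * b powr p"
    if ab: "a \<ge> 0" "b \<ge> 0" for a b :: real
  proof -
    \<comment> \<open>Convexity of \<open>powr\<close> is invoked for positive arguments only; when
      one argument is 0, the claim reduces to \<open>s powr p \<le> s\<close> for \<open>s\<close>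
      between 0 and 1.\<close>
    have small: "(s * c) powr p \<le> s * c powr p" if "0 < s" "s < 1" "c \<ge> 0" for s c :: real
    proof -
      have "s powr p \<le> s" using powr_mono'[of 1 p s] that p by simp
      then show ?thesis using that by (simp add: powr_mult mult_right_mono)
    qed
    consider "a = 0" | "b = 0" | "a > 0" "b > 0" using ab by linarith
    then show ?thesis
    proof cases
      case 3
      then show ?thesis using convex_onD[OF powr_convex[OF p], of t a b] t by simp
    qed (use small[of t b] small[of "1 - t" a] t ab p in auto)
  qed
  have "norm ((1 - t) *\<^sub>R x + t *\<^sub>R y) \<le> (1 - t) * norm x + t * norm y"
    using norm_triangle_ineq[of "(1 - t) *\<^sub>R x" "t *\<^sub>R y"] t by simp
  then have "norm ((1 - t) *\<^sub>R x + t *\<^sub>R y) powr p \<le> ((1 - t) * norm x + t * norm y) powr p"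
    using p by (intro powr_mono2) auto
  also have "\<dots> \<le> (1 - t) * norm x powr p + t * norm y powr p" by (rule aux) auto
  finally show "norm ((1 - t) *\<^sub>R x + t *\<^sub>R y) powr p \<le> (1 - t) * norm x powr p + t * norm y powr p" .
qed simp

lemma closed_epigraph_norm_powr:
  fixes U :: "'b::real_normed_vector set"
  assumes "closed U" "p > 0"
  shows "closed (epigraph U (\<lambda>v. norm v powr p))"
proof -
  have "epigraph U (\<lambda>v. norm v powr p) = (U \<times> UNIV) \<inter> {q. norm (fst q) powr p \<le> snd q}"
    by (auto simp: epigraph_def)
  moreover have "closed {q::'b \<times> real. norm (fst q) powr p \<le> snd q}"
    using \<open>p > 0\<close> by (intro closed_Collect_le continuous_intros continuous_on_powr') auto
  ultimately show ?thesis using \<open>closed U\<close> by (auto intro: closed_Times)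
qed

text \<open>Time integrals in the definitions use the completed measure, products with
  \<open>\<gamma>\<close> the Borel version; this equivalence passes between the two for null
  sets.\<close>

lemma AE_lebesgue_on_Icc:
  "(AE t in lebesgue_on {a..b::real}. P t) \<longleftrightarrow> (AE t in restrict_space lborel {a..b}. P t)"
  by (simp add: AE_restrict_space_iff AE_completion_iff)

lemma finite_measure_lborel_Icc: "finite_measure (restrict_space lborel {a..b::real})"
  by (rule finite_measureI) (simp add: emeasure_restrict_space emeasure_lborel_Icc_eq)

lemma measurable_lborel_Icc_pair:
  "(\<lambda>q. q) \<in> restrict_space lborel {a..b::real} \<Otimes>\<^sub>M \<gamma> \<rightarrow>\<^sub>M borel \<Otimes>\<^sub>M \<gamma>"
proof -
  have "(\<lambda>t. t) \<in> restrict_space lborel {a..b} \<rightarrow>\<^sub>M borel" by (rule measurable_restrict_space1) simp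
  then show ?thesis
    using measurable_compose[OF measurable_fst] by (auto simp: measurable_pair_iff comp_def)
qed

text \<open>Fubini for null sets. Closedness of \<open>U\<close> and joint measurability of
  \<open>w\<close> make the set of admissible \<open>(t, z)\<close> measurable, as the exchange of
  the two quantifiers requires.\<close>

lemma AE_swap_closed:
  fixes w :: "real \<Rightarrow> 'z \<Rightarrow> 'b::second_countable_topology"
  assumes "prob_space \<gamma>" and w: "(\<lambda>(t, z). w t z) \<in> borel_measurable (borel \<Otimes>\<^sub>M \<gamma>)"
    and "closed U" and AE: "AE z in \<gamma>. AE t in lebesgue_on {0..T}. w t z \<in> U"
  shows "AE t in restrict_space lborel {0..T}. AE z in \<gamma>. w t z \<in> U"
    and "AE q in restrict_space lborel {0..T} \<Otimes>\<^sub>M \<gamma>. (case q of (t, z) \<Rightarrow> w t z) \<in> U"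
proof -
  interpret G: prob_space \<gamma> by fact
  define \<Lambda> where "\<Lambda> = restrict_space lborel {0..T}"
  interpret L: finite_measure \<Lambda> unfolding \<Lambda>_def by (rule finite_measure_lborel_Icc)
  interpret P: pair_sigma_finite \<Lambda> \<gamma> ..
  have w': "(\<lambda>(t, z). w t z) \<in> borel_measurable (\<Lambda> \<Otimes>\<^sub>M \<gamma>)"
    using measurable_compose[OF measurable_lborel_Icc_pair w] by (simp add: \<Lambda>_def)
  have "AE z in \<gamma>. AE t in \<Lambda>. w t z \<in> U"
    using AE by (simp only: AE_lebesgue_on_Icc \<Lambda>_def)
  moreover have Uw: "{q \<in> space (\<Lambda> \<Otimes>\<^sub>M \<gamma>). (case q of (t, z) \<Rightarrow> w t z) \<in> U} \<in> sets (\<Lambda> \<Otimes>\<^sub>M \<gamma>)"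
    using measurable_sets[OF w' borel_closed[OF \<open>closed U\<close>]] by (simp add: vimage_def Int_def conj_commute)
  ultimately show 1: "AE t in restrict_space lborel {0..T}. AE z in \<gamma>. w t z \<in> U"
    unfolding \<Lambda>_def[symmetric] by (subst P.AE_commute) (auto simp: case_prod_beta')
  show "AE q in restrict_space lborel {0..T} \<Otimes>\<^sub>M \<gamma>. (case q of (t, z) \<Rightarrow> w t z) \<in> U"
    using 1 Uw unfolding \<Lambda>_def[symmetric] by (intro P.AE_pair_measure) auto
qed

lemma lebesgue_on_Icc_borel_integral:
  fixes g :: "real \<Rightarrow> real"
  assumes g: "g \<in> borel_measurable (restrict_space lborel {a..b})"
  shows "integrable (lebesgue_on {a..b}) g \<longleftrightarrow> integrable (restrict_space lborel {a..b}) g"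
    and "(\<integral>t. g t \<partial>lebesgue_on {a..b}) = (\<integral>t. g t \<partial>restrict_space lborel {a..b})"
proof -
  have m: "(\<lambda>t. indicator {a..b} t *\<^sub>R g t) \<in> borel_measurable lborel"
    using g by (subst (asm) borel_measurable_restrict_space_iff) auto
  show "integrable (lebesgue_on {a..b}) g \<longleftrightarrow> integrable (restrict_space lborel {a..b}) g"
    using m by (simp add: integrable_restrict_space integrable_completion)
  show "(\<integral>t. g t \<partial>lebesgue_on {a..b}) = (\<integral>t. g t \<partial>restrict_space lborel {a..b})"
    using m by (simp add: integral_restrict_space integral_completion)
qed

lemma borel_measurable_if_continuous:
  fixes h :: "'a::topological_space \<Rightarrow> 'b::{topological_space, zero}"
  assumes "continuous_on S h" "S \<in> sets borel"
  shows "(\<lambda>q. if q \<in> S then h q else 0) \<in> borel_measurable borel"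
  using borel_measurable_continuous_on_restrict[OF assms(1)] assms(2)
  by (subst (asm) measurable_restrict_space_iff[where c = 0]) auto

text \<open>Disintegration in time of the image measure: Fubini upstairs on
  \<open>\<Lambda> \<Otimes>\<^sub>M \<gamma>\<close> and a change of variables in each slice. It
  turns integrals over space-time into the iterated integrals of the continuity equation.\<close>

lemma integrable_slices:
  fixes X :: "'s::second_countable_topology \<Rightarrow> 'z \<Rightarrow> 'b::second_countable_topology" and h :: "'s \<times> 'b \<Rightarrow> real"
  assumes "sigma_finite_measure \<Lambda>" "sigma_finite_measure \<gamma>"
    and [measurable]: "(\<lambda>t. t) \<in> \<Lambda> \<rightarrow>\<^sub>M borel"
    and X[measurable]: "(\<lambda>(t, z). X t z) \<in> borel_measurable (\<Lambda> \<Otimes>\<^sub>M \<gamma>)"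
    and [measurable]: "h \<in> borel_measurable borel"
    and h: "integrable (distr (\<Lambda> \<Otimes>\<^sub>M \<gamma>) borel (\<lambda>(t, z). (t, X t z))) h"
  shows "AE t in \<Lambda>. integrable (distr \<gamma> borel (X t)) (\<lambda>x. h (t, x))"
    and "integrable \<Lambda> (\<lambda>t. \<integral>x. h (t, x) \<partial>distr \<gamma> borel (X t))"
    and "(\<integral>t. (\<integral>x. h (t, x) \<partial>distr \<gamma> borel (X t)) \<partial>\<Lambda>)
      = (\<integral>q. h q \<partial>distr (\<Lambda> \<Otimes>\<^sub>M \<gamma>) borel (\<lambda>(t, z). (t, X t z)))"
proof -
  interpret L: sigma_finite_measure \<Lambda> by fact
  interpret G: sigma_finite_measure \<gamma> by fact
  interpret pair_sigma_finite \<Lambda> \<gamma> ..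
  have \<Phi>[measurable]: "(\<lambda>(t, z). (t, X t z)) \<in> borel_measurable (\<Lambda> \<Otimes>\<^sub>M \<gamma>)"
    by (simp add: case_prod_beta')
  have Xt: "X t \<in> borel_measurable \<gamma>" if "t \<in> space \<Lambda>" for t
    using measurable_Pair2[OF X that] by simp
  have ht: "(\<lambda>x. h (t, x)) \<in> borel_measurable borel" for t
    by (rule measurable_compose[of "Pair t" _ borel h]) auto
  define k where "k q = h (case q of (t, z) \<Rightarrow> (t, X t z))" for q
  have k: "integrable (\<Lambda> \<Otimes>\<^sub>M \<gamma>) k"
    using h unfolding k_def by (subst (asm) integrable_distr_eq) auto
  have eq: "(\<integral>x. h (t, x) \<partial>distr \<gamma> borel (X t)) = (\<integral>z. k (t, z) \<partial>\<gamma>)" if "t \<in> space \<Lambda>" for t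
    using Xt[OF that] ht by (subst integral_distr) (auto simp: k_def)
  show "AE t in \<Lambda>. integrable (distr \<gamma> borel (X t)) (\<lambda>x. h (t, x))"
    using AE_integrable_fst'[OF k] AE_space
    by eventually_elim (use Xt ht in \<open>auto simp: integrable_distr_eq k_def\<close>)
  show "integrable \<Lambda> (\<lambda>t. \<integral>x. h (t, x) \<partial>distr \<gamma> borel (X t))"
    using integrable_fst'[OF k] by (simp add: eq cong: Bochner_Integration.integrable_cong)
  have "(\<integral>t. (\<integral>x. h (t, x) \<partial>distr \<gamma> borel (X t)) \<partial>\<Lambda>) = (\<integral>t. (\<integral>z. k (t, z) \<partial>\<gamma>) \<partial>\<Lambda>)"
    by (intro Bochner_Integration.integral_cong) (auto simp: eq)
  also have "\<dots> = (\<integral>q. k q \<partial>(\<Lambda> \<Otimes>\<^sub>M \<gamma>))" by (rule integral_fst'[OF k])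
  also have "\<dots> = (\<integral>q. h q \<partial>distr (\<Lambda> \<Otimes>\<^sub>M \<gamma>) borel (\<lambda>(t, z). (t, X t z)))"
    by (subst integral_distr) (auto simp: k_def intro!: Bochner_Integration.integral_cong)
  finally show "(\<integral>t. (\<integral>x. h (t, x) \<partial>distr \<gamma> borel (X t)) \<partial>\<Lambda>)
      = (\<integral>q. h q \<partial>distr (\<Lambda> \<Otimes>\<^sub>M \<gamma>) borel (\<lambda>(t, z). (t, X t z)))" .
qed

lemma narrowly_continuous_distr:
  fixes X :: "real \<Rightarrow> 'z \<Rightarrow> real^'d"
  assumes "prob_space \<gamma>" and X: "\<And>t. t \<in> I \<Longrightarrow> X t \<in> borel_measurable \<gamma>"
    and cont: "\<And>z. z \<in> space \<gamma> \<Longrightarrow> continuous_on I (\<lambda>t. X t z)"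
  shows "narrowly_continuous_on I (\<lambda>t. distr \<gamma> borel (X t))"
  unfolding narrowly_continuous_on_def
proof (intro allI impI, elim conjE)
  interpret prob_space \<gamma> by fact
  fix g :: "real^'d \<Rightarrow> real" assume g: "continuous_on UNIV g" "bounded (range g)"
  then obtain B where B: "\<And>x. norm (g x) \<le> B" by (auto simp: bounded_iff)
  have gm[measurable]: "g \<in> borel_measurable borel" using g(1) by (rule borel_measurable_continuous_onI)
  have eq: "(\<integral>x. g x \<partial>distr \<gamma> borel (X t)) = (\<integral>z. g (X t z) \<partial>\<gamma>)" if "t \<in> I" for t
    using X[OF that] by (intro integral_distr) auto
  show "continuous_on I (\<lambda>t. \<integral>x. g x \<partial>distr \<gamma> borel (X t))"
    unfolding continuous_on_sequentially
  proof (intro allI ballI impI, elim conjE)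
    fix s t assume s: "\<forall>n. s n \<in> I" "s \<longlonglongrightarrow> t" and t: "t \<in> I"
    have "(\<lambda>n. \<integral>z. g (X (s n) z) \<partial>\<gamma>) \<longlonglongrightarrow> (\<integral>z. g (X t z) \<partial>\<gamma>)"
    proof (rule integral_dominated_convergence[where w = "\<lambda>_. B"])
      show "AE z in \<gamma>. (\<lambda>n. g (X (s n) z)) \<longlonglongrightarrow> g (X t z)"
      proof (rule AE_I2)
        fix z assume "z \<in> space \<gamma>"
        then have "(\<lambda>n. X (s n) z) \<longlonglongrightarrow> X t z"
          using s t by (intro continuous_on_tendsto_compose[OF cont]) auto
        then show "(\<lambda>n. g (X (s n) z)) \<longlonglongrightarrow> g (X t z)"
          by (intro continuous_on_tendsto_compose[OF g(1)]) auto
      qed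
    qed (use X s t B in \<open>auto intro: measurable_compose[OF _ gm]\<close>)
    then show "((\<lambda>t. \<integral>x. g x \<partial>distr \<gamma> borel (X t)) \<circ> s) \<longlonglongrightarrow> (\<integral>x. g x \<partial>distr \<gamma> borel (X t))"
      using s t by (simp add: eq comp_def)
  qed
qed

lemma C1_map_borel_measurable: "C1_map h \<Longrightarrow> h \<in> borel_measurable borel"
  unfolding C1_map_def
  by (intro borel_measurable_continuous_onI continuous_at_imp_continuous_on ballI)
     (blast intro: has_derivative_continuous)

text \<open>With \<open>y\<close> the gradient of a test function, the coefficients of this affine
  expression depend on time and position only; this is what lets conditioning on them replace a
  control by its mean.\<close>

lemma inner_ctrl_field:
  "y \<bullet> ctrl_field f0 f x v = y \<bullet> f0 x + (\<Sum>i\<in>UNIV. (y \<bullet> f i x) * v $ i)"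
  by (simp add: ctrl_field_def inner_add_right inner_sum_right mult.commute)

text \<open>The analytic core, free of the cost and of \<open>Omega\<close>: coercivity has been
  reduced to integrability of \<open>|w|^p\<close>, and the choice of representatives to joint
  measurability of \<open>X\<close> and \<open>w\<close>.\<close>

lemma curves_solve_continuity_equation:
  fixes X :: "real \<Rightarrow> 'z \<Rightarrow> real^'d" and w :: "real \<Rightarrow> 'z \<Rightarrow> real^'n"
  assumes T: "T > 0" and p: "p \<ge> 1" and U: "closed U" "convex U"
    and growth: "sublinear_growth f0 f" and prob: "prob_space \<gamma>"
    and Xm: "(\<lambda>(t, z). X t z) \<in> borel_measurable (borel \<Otimes>\<^sub>M \<gamma>)"
    and wm: "(\<lambda>(t, z). w t z) \<in> borel_measurable (borel \<Otimes>\<^sub>M \<gamma>)"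
    and Xc: "\<And>z. z \<in> space \<gamma> \<Longrightarrow> continuous_on {0..T} (\<lambda>t. X t z)"
    and curves: "AE z in \<gamma>. absolutely_continuous_on 0 T (\<lambda>t. X t z) \<and>
      (AE t in lebesgue_on {0..T}. w t z \<in> U \<and>
        ((\<lambda>t. X t z) has_vector_derivative ctrl_field f0 f (X t z) (w t z)) (at t within {0..T}))"
    and wp: "integrable (restrict_space lborel {0..T} \<Otimes>\<^sub>M \<gamma>) (\<lambda>(t, z). norm (w t z) powr p)"
  shows "\<exists>u. solves_continuity_equation T U f0 f (\<lambda>t. distr \<gamma> borel (X t)) u \<and>
    (AE t in lebesgue_on {0..T}. u t \<in> Lp_functions (distr \<gamma> borel (X t)) p)"
proof -
  interpret G: prob_space \<gamma> by fact
  define \<Lambda> where "\<Lambda> = restrict_space lborel {0..T}"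
  have space_\<Lambda>[simp]: "space \<Lambda> = {0..T}" by (simp add: \<Lambda>_def)
  interpret L: finite_measure \<Lambda>
    unfolding \<Lambda>_def by (rule finite_measure_lborel_Icc)
  interpret P: pair_sigma_finite \<Lambda> \<gamma> ..

  \<comment> \<open>The space-time measure and its time slices\<close>
  define m where "m = \<Lambda> \<Otimes>\<^sub>M \<gamma>"
  have "finite_measure m" unfolding m_def by (intro finite_measure_pair_measure L.finite_measure_axioms G.finite_measure_axioms)
  then interpret m: finite_measure m .
  have id\<Lambda>: "(\<lambda>t. t) \<in> \<Lambda> \<rightarrow>\<^sub>M borel" unfolding \<Lambda>_def by (rule measurable_restrict_space1) simp
  have id_m: "(\<lambda>q. q) \<in> m \<rightarrow>\<^sub>M (borel \<Otimes>\<^sub>M \<gamma>)"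
    unfolding m_def \<Lambda>_def by (rule measurable_lborel_Icc_pair)
  have Xm'[measurable]: "(\<lambda>(t, z). X t z) \<in> borel_measurable (\<Lambda> \<Otimes>\<^sub>M \<gamma>)"
    and wm'[measurable]: "(\<lambda>(t, z). w t z) \<in> borel_measurable m"
    using measurable_compose[OF id_m Xm] measurable_compose[OF id_m wm] by (auto simp: m_def)
  have Xt[measurable]: "X t \<in> borel_measurable \<gamma>" for t using measurable_Pair2[OF Xm, of t] by simp
  define \<Phi> where "\<Phi> = (\<lambda>(t, z). (t, X t z))"
  have \<Phi>m[measurable]: "\<Phi> \<in> borel_measurable m"
    using borel_measurable_Pair[OF measurable_compose[OF measurable_fst id\<Lambda>] Xm']
    by (simp add: \<Phi>_def m_def case_prod_beta')
  define M where "M = distr m borel \<Phi>"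
  interpret M: finite_measure M unfolding M_def by (rule m.finite_measure_distr) (rule \<Phi>m)
  define \<mu> where "\<mu> t = distr \<gamma> borel (X t)" for t
  have slices: "AE t in \<Lambda>. integrable (\<mu> t) (\<lambda>x. h (t, x))" "integrable \<Lambda> (\<lambda>t. \<integral>x. h (t, x) \<partial>\<mu> t)"
    "(\<integral>t. (\<integral>x. h (t, x) \<partial>\<mu> t) \<partial>\<Lambda>) = (\<integral>q. h q \<partial>M)"
    if "h \<in> borel_measurable borel" "integrable M h" for h :: "real \<times> (real^'d) \<Rightarrow> real"
    using integrable_slices[OF L.sigma_finite_measure_axioms G.sigma_finite_measure_axioms id\<Lambda> Xm', of h] that
    by (auto simp: M_def \<mu>_def \<Phi>_def m_def)

  \<comment> \<open>The conditional mean of the control and of its power\<close>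
  have "AE z in \<gamma>. AE t in lebesgue_on {0..T}. w t z \<in> U"
    using curves by (rule eventually_mono) (erule conjE, erule eventually_mono, simp)
  then have wU: "AE q in m. (case q of (t, z) \<Rightarrow> w t z) \<in> U"
    unfolding m_def \<Lambda>_def by (rule AE_swap_closed(2)[OF prob wm U(1)])
  \<comment> \<open>Pairing \<open>w\<close> with its power makes a single function \<open>g\<close>
    carry both means. Integrability follows from \<open>s \<le> 1 + s powr p\<close>, which is also
    the source of the factor 2.\<close>
  define W where "W = (\<lambda>(t, z). (w t z, norm (w t z) powr p))"
  have W: "integrable m W"
  proof (rule Bochner_Integration.integrable_bound)
    show "integrable m (\<lambda>q. 1 + 2 * (case q of (t, z) \<Rightarrow> norm (w t z) powr p))"
      using wp unfolding m_def[symmetric] \<Lambda>_def[symmetric]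
      by (intro Bochner_Integration.integrable_add integrable_mult_right) auto
    show "W \<in> borel_measurable m"
      using wm' unfolding W_def case_prod_beta' by measurable
    show "AE q in m. norm (W q) \<le> norm (1 + 2 * (case q of (t, z) \<Rightarrow> norm (w t z) powr p))"
    proof (rule AE_I2, clarify)
      fix t z
      show "norm (W (t, z)) \<le> norm (1 + 2 * norm (w t z) powr p)"
        using le_add_powr[of "norm (w t z)" 1 p] p norm_Pair_le[of "w t z" "norm (w t z) powr p"]
        by (simp add: W_def)
    qed
  qed
  obtain g where gm[measurable]: "g \<in> borel_measurable borel" and gi: "integrable M g"
    and mean: "\<And>(h::real \<times> (real^'d) \<Rightarrow> real) C. \<lbrakk>h \<in> borel_measurable borel; \<And>q. q \<in> space borel \<Longrightarrow> \<bar>h q\<bar> \<le> C\<rbrakk>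
      \<Longrightarrow> (\<integral>q. h (\<Phi> q) *\<^sub>R W q \<partial>m) = (\<integral>q. h q *\<^sub>R g q \<partial>M)"
  proof (rule conditional_mean[OF \<Phi>m m.finite_measure_axioms W, folded M_def])
    fix g
    assume 1: "g \<in> borel_measurable borel" "integrable M g"
      and 2: "\<And>(h::real \<times> (real^'d) \<Rightarrow> real) C. \<lbrakk>h \<in> borel_measurable borel; \<And>q. q \<in> space borel \<Longrightarrow> \<bar>h q\<bar> \<le> C\<rbrakk>
      \<Longrightarrow> (\<integral>q. h (\<Phi> q) *\<^sub>R W q \<partial>m) = (\<integral>q. h q *\<^sub>R g q \<partial>M)"
    show thesis using 1 2 by (rule that)
  qed
  \<comment> \<open>Jensen's inequality: the pair \<open>(w, |w|\<^sup>p)\<close> lies in the epigraph, hence so does its conditional mean.\<close>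
  have gK: "AE q in M. g q \<in> epigraph U (\<lambda>v. norm v powr p)"
    unfolding M_def
  proof (rule conditional_mean_in_closed_convex[OF \<Phi>m m.finite_measure_axioms W gm gi[unfolded M_def]
        mean[unfolded M_def]])
    show "closed (epigraph U (\<lambda>v. norm v powr p))" using U p by (intro closed_epigraph_norm_powr) auto
    show "convex (epigraph U (\<lambda>v. norm v powr p))"
      using convex_on_subset[OF convex_on_norm_powr[OF p] subset_UNIV U(2)] by (simp add: convex_epigraph U)
    show "AE q in m. W q \<in> epigraph U (\<lambda>v. norm v powr p)"
      using wU by eventually_elim (auto simp: W_def epigraph_def)
  qed
  \<comment> \<open>Since \<open>m\<close> has mass \<open>T > 0\<close>, membership in
    \<open>U\<close> that holds almost everywhere produces an actual point of \<open>U\<close>, the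
    default value \<open>u0\<close>.\<close>
  have "emeasure m (space m) = emeasure \<Lambda> {0..T}"
    using G.emeasure_pair_measure_Times[OF sets.top[of \<Lambda>] sets.top[of \<gamma>]]
    by (simp add: m_def space_pair_measure G.emeasure_space_1)
  also have "\<dots> = ennreal T" using T by (simp add: \<Lambda>_def emeasure_restrict_space)
  finally have "emeasure m (space m) \<noteq> 0" using T by simp
  then have "U \<noteq> {}"
    using wU by (auto simp: eventually_False ae_filter_eq_bot_iff)
  then obtain u0 where u0: "u0 \<in> U" by blast
  \<comment> \<open>Admissibility is required at every point, so the mean is corrected where it
    leaves \<open>U\<close>, which happens only on an \<open>M\<close>-null set.\<close>
  define v where "v q = (if fst (g q) \<in> U then fst (g q) else u0)" for q
  have [measurable]: "(\<lambda>q. fst (g q)) \<in> borel_measurable borel" "U \<in> sets borel"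
    using borel_measurable_continuous_on[OF continuous_on_fst[OF continuous_on_id] gm] U(1) by auto
  have vm[measurable]: "v \<in> borel_measurable borel"
    unfolding v_def by measurable
  have [measurable]: "(\<lambda>q. v q $ i) \<in> borel_measurable borel" for i
    by (rule borel_measurable_continuous_on[OF _ vm]) (intro continuous_intros)
  have vU: "v q \<in> U" for q using u0 by (simp add: v_def)
  have vg: "AE q in M. v q = fst (g q) \<and> norm (v q) powr p \<le> snd (g q)"
    using gK by eventually_elim (auto simp: v_def epigraph_def)
  \<comment> \<open>By membership in the epigraph, the second component of \<open>g\<close> is an
    integrable majorant of the power.\<close>
  have vp: "integrable M (\<lambda>q. norm (v q) powr p)"
  proof (rule Bochner_Integration.integrable_bound)
    show "integrable M (\<lambda>q. snd (g q))" using gi by (rule integrable_bounded_linear[OF bounded_linear_snd])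
    show "(\<lambda>q. norm (v q) powr p) \<in> borel_measurable M" by (simp add: M_def)
    show "AE q in M. norm (norm (v q) powr p) \<le> norm (snd (g q))"
      using vg by eventually_elim auto
  qed
  have vpm: "(\<lambda>q. norm (v q) powr p) \<in> borel_measurable borel" by measurable
  have vi: "integrable M v"
    using Lp_functions_integrable[OF M.finite_measure_axioms p, of v] vp
    by (simp add: Lp_functions_def M_def)
  define u where "u t x = v (t, x)" for t x
  have ut: "u t \<in> borel_measurable borel" for t
    unfolding u_def by (rule measurable_compose[of "Pair t" _ borel v]) auto
  have Lp: "AE t in lebesgue_on {0..T}. u t \<in> Lp_functions (\<mu> t) p"
    unfolding AE_lebesgue_on_Icc \<Lambda>_def[symmetric]
    using slices(1)[OF vpm vp] by eventually_elim (use ut in \<open>auto simp: Lp_functions_def u_def \<mu>_def\<close>)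

  \<comment> \<open>The weak equation against a test function\<close>
  have "solves_continuity_equation T U f0 f \<mu> u"
    unfolding solves_continuity_equation_def
  proof (intro conjI allI impI ballI)
    show "(\<lambda>(t, x). u t x) \<in> borel_measurable (restrict_space borel ({0..T} \<times> UNIV))"
      unfolding u_def by (intro measurable_restrict_space1) simp
    show "u t x \<in> U" for t x by (simp add: u_def vU)
    show "\<mu> t \<in> space (prob_algebra borel)" for t
      by (simp add: \<mu>_def space_prob_algebra G.prob_space_distr)
    show "narrowly_continuous_on {0..T} \<mu>"
      unfolding \<mu>_def using prob Xt Xc by (rule narrowly_continuous_distr)
    fix \<phi> \<phi>t :: "real \<times> (real^'d) \<Rightarrow> real" and \<phi>x assume \<phi>: "C1c_test T \<phi> \<phi>t \<phi>x"
    let ?S = "{0..T} \<times> (UNIV :: (real^'d) set)"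
    obtain C R where C: "C \<ge> 0" and R: "R \<ge> 0"
      and bnd: "\<And>q. q \<in> ?S \<Longrightarrow> \<bar>\<phi> q\<bar> \<le> C \<and> \<bar>\<phi>t q\<bar> \<le> C \<and> norm (\<phi>x q) \<le> C"
      and supp: "\<And>q. \<lbrakk>q \<in> ?S; norm (snd q) > R\<rbrakk> \<Longrightarrow> \<phi>x q = 0"
      and \<phi>c: "continuous_on ?S \<phi>"
      using C1c_test_bounds[OF T \<phi>] by metis
    obtain B where B: "B > 0" "\<And>x. norm (f0 x) \<le> B * (norm x + 1)" "\<And>x i. norm (f i x) \<le> B * (norm x + 1)"
      using growth unfolding sublinear_growth_def by metis
    have f0m[measurable]: "f0 \<in> borel_measurable borel" and fm[measurable]: "\<And>i. f i \<in> borel_measurable borel"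
      using growth by (auto simp: sublinear_growth_def intro: C1_map_borel_measurable)
    \<comment> \<open>The partial derivatives are constrained on the slab only; the extension by 0
      makes them Borel on the whole space.\<close>
    define \<psi>t where "\<psi>t q = (if q \<in> ?S then \<phi>t q else 0)" for q
    define \<psi>x where "\<psi>x q = (if q \<in> ?S then \<phi>x q else 0)" for q
    have [measurable]: "\<psi>t \<in> borel_measurable borel" "\<psi>x \<in> borel_measurable borel"
      unfolding \<psi>t_def \<psi>x_def using \<phi>
      by (auto simp: C1c_test_def intro!: borel_measurable_if_continuous borel_closed closed_Times)
    define A0 where "A0 q = \<psi>t q + \<psi>x q \<bullet> f0 (snd q)" for q
    define A where "A i q = \<psi>x q \<bullet> f i (snd q)" for i q
    have A0m[measurable]: "A0 \<in> borel_measurable borel" and Am[measurable]: "A i \<in> borel_measurable borel" for i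
    proof -
      have "snd \<in> borel_measurable (borel :: (real \<times> (real^'d)) measure)"
        by (intro borel_measurable_continuous_onI continuous_intros)
      then have "(\<lambda>q::real \<times> (real^'d). f0 (snd q)) \<in> borel_measurable borel"
        "(\<lambda>q::real \<times> (real^'d). f i (snd q)) \<in> borel_measurable borel"
        using measurable_compose[OF _ f0m] measurable_compose[OF _ fm] by auto
      then show "A0 \<in> borel_measurable borel" "A i \<in> borel_measurable borel"
        unfolding A0_def A_def by auto
    qed
    \<comment> \<open>Outside radius \<open>R\<close> the gradient vanishes, inside it the growth
      bound is at most \<open>B * (R + 1)\<close>.\<close>
    have bnd_inner: "\<bar>\<psi>x q \<bullet> h (snd q)\<bar> \<le> C * (B * (R + 1))"
      if h: "\<And>x. norm (h x) \<le> B * (norm x + 1)" for h :: "real^'d \<Rightarrow> real^'d" and q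
    proof (cases "q \<in> ?S \<and> norm (snd q) \<le> R")
      case True
      have "\<bar>\<psi>x q \<bullet> h (snd q)\<bar> \<le> norm (\<psi>x q) * norm (h (snd q))" by (rule Cauchy_Schwarz_ineq2)
      also have "\<dots> \<le> C * (B * (norm (snd q) + 1))"
        using True bnd[of q] h[of "snd q"] C by (intro mult_mono) (auto simp: \<psi>x_def)
      also have "\<dots> \<le> C * (B * (R + 1))" using True B C by (intro mult_left_mono) auto
      finally show ?thesis .
    next
      case False
      then have "\<psi>x q = 0" using supp[of q] by (auto simp: \<psi>x_def)
      then show ?thesis using B C R by simp
    qed
    define C' where "C' = C + C * (B * (R + 1))"
    have Ab: "\<bar>A i q\<bar> \<le> C'" for i q
      using bnd_inner[of "f i" q, OF B(3)] C by (simp add: A_def C'_def)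
    have A0b: "\<bar>A0 q\<bar> \<le> C'" for q
    proof -
      have "\<bar>\<psi>t q\<bar> \<le> C" using bnd[of q] C by (auto simp: \<psi>t_def)
      then show ?thesis using bnd_inner[of f0 q, OF B(2)] by (simp add: A0_def C'_def)
    qed
    \<comment> \<open>For times in \<open>{0..T}\<close>, \<open>k\<close> is the derivative of
      \<open>\<phi>\<close> along a single curve with its own control \<open>w\<close>, and
      \<open>H\<close> the same expression at a position with the mean control \<open>v\<close>. The
      aim is that their integrals agree.\<close>
    define H where "H q = A0 q + (\<Sum>i\<in>UNIV. A i q * v q $ i)" for q
    define k where "k = (\<lambda>(t, z). A0 (t, X t z) + (\<Sum>i\<in>UNIV. A i (t, X t z) * w t z $ i))"
    have A0i: "integrable M A0"
      using A0b by (intro M.integrable_const_bound[where B = C']) (auto simp: M_def)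
    have Ai: "integrable M (\<lambda>q. A i q * v q $ i)" for i
      using integrable_bounded_mult[of M "\<lambda>q. v q $ i" "A i" C'] Ab vi
        integrable_bounded_linear[OF bounded_linear_vec_nth vi, of i]
      by (auto simp: M_def)
    have Hi: "integrable M H" unfolding H_def using A0i Ai by auto
    have Hm: "H \<in> borel_measurable borel" unfolding H_def by measurable
    have wi: "integrable m (\<lambda>(t, z). w t z)"
      using integrable_bounded_linear[OF bounded_linear_fst W] by (simp add: W_def case_prod_beta')
    have k0: "integrable m (\<lambda>q. A0 (\<Phi> q))"
      using A0b by (intro m.integrable_const_bound[where B = C']) auto
    have ki: "integrable m (\<lambda>q. A i (\<Phi> q) * (case q of (t, z) \<Rightarrow> w t z) $ i)" for i
      using integrable_bounded_mult[OF integrable_bounded_linear[OF bounded_linear_vec_nth wi, of i],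
          of "\<lambda>q. A i (\<Phi> q)" C'] Ab by auto
    have k_eq: "k q = A0 (\<Phi> q) + (\<Sum>i\<in>UNIV. A i (\<Phi> q) * (case q of (t, z) \<Rightarrow> w t z) $ i)" for q
      by (simp add: k_def \<Phi>_def case_prod_beta')
    have k: "integrable m k" unfolding k_eq using k0 ki by auto
    \<comment> \<open>The conditional mean is tested with the bounded function \<open>A i\<close>;
      the vector \<open>?e\<close> picks coordinate \<open>i\<close> of its first component.\<close>
    have tower: "(\<integral>q. A i (\<Phi> q) * (case q of (t, z) \<Rightarrow> w t z) $ i \<partial>m) = (\<integral>q. A i q * v q $ i \<partial>M)" for i
    proof -
      let ?e = "(axis i 1, 0) :: (real^'n) \<times> real"
      have e: "y \<bullet> ?e = fst y $ i" for y by (cases y) (simp add: inner_axis)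
      have i1: "integrable m (\<lambda>q. A i (\<Phi> q) *\<^sub>R W q)"
        using integrable_bounded_mult[OF W, of "\<lambda>q. A i (\<Phi> q)" C'] Ab by auto
      have i2: "integrable M (\<lambda>q. A i q *\<^sub>R g q)"
        using integrable_bounded_mult[OF gi, of "A i" C'] Ab by (auto simp: M_def)
      have "(\<integral>q. A i (\<Phi> q) * (case q of (t, z) \<Rightarrow> w t z) $ i \<partial>m) = (\<integral>q. (A i (\<Phi> q) *\<^sub>R W q) \<bullet> ?e \<partial>m)"
        by (simp add: e W_def case_prod_beta')
      also have "\<dots> = (\<integral>q. A i (\<Phi> q) *\<^sub>R W q \<partial>m) \<bullet> ?e" using i1 by (intro integral_inner_left)
      also have "\<dots> = (\<integral>q. A i q *\<^sub>R g q \<partial>M) \<bullet> ?e" using mean[of "A i" C'] Ab by simp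
      also have "\<dots> = (\<integral>q. (A i q *\<^sub>R g q) \<bullet> ?e \<partial>M)" using i2 by (intro integral_inner_left[symmetric])
      also have "\<dots> = (\<integral>q. A i q * v q $ i \<partial>M)"
      proof (rule integral_cong_AE)
        show "AE q in M. (A i q *\<^sub>R g q) \<bullet> ?e = A i q * v q $ i"
          using vg by eventually_elim (simp add: e)
      qed (auto simp: M_def)
      finally show ?thesis .
    qed
    have "(\<integral>q. k q \<partial>m) = (\<integral>q. A0 (\<Phi> q) \<partial>m) + (\<Sum>i\<in>UNIV. \<integral>q. A i (\<Phi> q) * (case q of (t, z) \<Rightarrow> w t z) $ i \<partial>m)"
      unfolding k_eq using k0 ki by (simp add: Bochner_Integration.integral_sum)
    also have "\<dots> = (\<integral>q. A0 q \<partial>M) + (\<Sum>i\<in>UNIV. \<integral>q. A i q * v q $ i \<partial>M)"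
      by (simp only: tower) (simp add: M_def integral_distr)
    also have "\<dots> = (\<integral>q. H q \<partial>M)"
      unfolding H_def using A0i Ai by (simp add: Bochner_Integration.integral_sum)
    finally have int_k: "(\<integral>q. k q \<partial>m) = (\<integral>q. H q \<partial>M)" .

    have \<phi>s: "(\<lambda>x. \<phi> (t, x)) \<in> borel_measurable borel" if "t \<in> {0..T}" for t
      using that by (intro borel_measurable_continuous_onI continuous_on_compose2[OF \<phi>c] continuous_intros) auto
    have \<phi>i: "integrable \<gamma> (\<lambda>z. \<phi> (t, X t z))" if "t \<in> {0..T}" for t
      using that bnd measurable_compose[OF Xt \<phi>s[OF that]]
      by (intro G.integrable_const_bound[where B = C]) auto
    \<comment> \<open>Fubini in the other order: with \<open>z\<close> fixed, the time integral
      follows one curve and collapses to the boundary terms.\<close>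
    have k': "integrable (\<Lambda> \<Otimes>\<^sub>M \<gamma>) (case_prod (\<lambda>t z. k (t, z)))" using k by (simp add: m_def)
    have "(\<integral>q. k q \<partial>m) = (\<integral>z. (\<integral>t. k (t, z) \<partial>\<Lambda>) \<partial>\<gamma>)"
      using P.integral_snd[OF k'] by (simp add: m_def)
    also have "\<dots> = (\<integral>z. \<phi> (T, X T z) - \<phi> (0, X 0 z) \<partial>\<gamma>)"
    proof (rule integral_cong_AE)
      show "(\<lambda>z. \<integral>t. k (t, z) \<partial>\<Lambda>) \<in> borel_measurable \<gamma>" using P.integrable_snd[OF k'] by simp
      show "(\<lambda>z. \<phi> (T, X T z) - \<phi> (0, X 0 z)) \<in> borel_measurable \<gamma>" using \<phi>i[of T] \<phi>i[of 0] T by auto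
      show "AE z in \<gamma>. (\<integral>t. k (t, z) \<partial>\<Lambda>) = \<phi> (T, X T z) - \<phi> (0, X 0 z)"
        using curves P.AE_integrable_snd[OF k']
      proof eventually_elim
        case (elim z)
        let ?k = "\<lambda>t. \<phi>t (t, X t z) + \<phi>x (t, X t z) \<bullet> ctrl_field f0 f (X t z) (w t z)"
        have "(?k has_integral \<phi> (T, X T z) - \<phi> (0, X 0 z)) {0..T}"
        proof (rule C1c_test_along_curve[OF T \<phi>])
          show "absolutely_continuous_on 0 T (\<lambda>t. X t z)" using elim by simp
          show "AE t in lebesgue_on {0..T}. ((\<lambda>t. X t z) has_vector_derivative
              ctrl_field f0 f (X t z) (w t z)) (at t within {0..T})"
            using elim(1) by (auto elim: eventually_mono)
        qed
        moreover have "?k t = k (t, z)" if "t \<in> {0..T}" for t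
          using that by (simp add: k_def A0_def A_def \<psi>t_def \<psi>x_def inner_ctrl_field)
        ultimately have 1: "((\<lambda>t. k (t, z)) has_integral \<phi> (T, X T z) - \<phi> (0, X 0 z)) {0..T}"
          by (rule has_integral_eq[rotated]) auto
        have m: "(\<lambda>t. k (t, z)) \<in> borel_measurable \<Lambda>" using elim(2) by simp
        \<comment> \<open>The chain rule yields a Henstock-Kurzweil integral; Lebesgue
          integrability, known from Fubini for almost every \<open>z\<close>, identifies the two
          values.\<close>
        then have "integrable (lebesgue_on {0..T}) (\<lambda>t. k (t, z))"
          using elim(2) lebesgue_on_Icc_borel_integral(1) unfolding \<Lambda>_def by blast
        then have "((\<lambda>t. k (t, z)) has_integral (\<integral>t. k (t, z) \<partial>lebesgue_on {0..T})) {0..T}"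
          by (rule has_integral_integral_lebesgue_on) simp
        then have "(\<integral>t. k (t, z) \<partial>lebesgue_on {0..T}) = \<phi> (T, X T z) - \<phi> (0, X 0 z)"
          using 1 by (rule has_integral_unique)
        then show ?case using m lebesgue_on_Icc_borel_integral(2) unfolding \<Lambda>_def by metis
      qed
    qed
    also have "\<dots> = (\<integral>z. \<phi> (T, X T z) \<partial>\<gamma>) - (\<integral>z. \<phi> (0, X 0 z) \<partial>\<gamma>)"
      using \<phi>i[of T] \<phi>i[of 0] T by simp
    also have "\<dots> = (\<integral>x. \<phi> (T, x) \<partial>\<mu> T) - (\<integral>x. \<phi> (0, x) \<partial>\<mu> 0)"
      unfolding \<mu>_def using \<phi>s[of T] \<phi>s[of 0] T by (simp add: integral_distr)
    finally have int_H: "(\<integral>q. H q \<partial>M) = (\<integral>x. \<phi> (T, x) \<partial>\<mu> T) - (\<integral>x. \<phi> (0, x) \<partial>\<mu> 0)"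
      using int_k by simp

    \<comment> \<open>Back from \<open>\<psi>t\<close> and \<open>\<psi>x\<close> to the given
      derivatives: \<open>h\<close> and \<open>H\<close> agree for times in \<open>{0..T}\<close>,
      the only ones that \<open>\<Lambda>\<close> sees.\<close>
    define h where "h t x = \<phi>t (t, x) + \<phi>x (t, x) \<bullet> ctrl_field f0 f x (u t x)" for t x
    have hH: "h t x = H (t, x)" if "t \<in> {0..T}" for t x
      using that by (simp add: h_def H_def A0_def A_def \<psi>t_def \<psi>x_def u_def inner_ctrl_field)
    have hH': "h t = (\<lambda>x. H (t, x))" if "t \<in> {0..T}" for t using hH[OF that] by (rule ext)
    have s1: "AE t in \<Lambda>. integrable (\<mu> t) (h t)"
      using slices(1)[OF Hm Hi] AE_space by eventually_elim (simp add: hH')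
    have hm: "integrable \<Lambda> (\<lambda>t. \<integral>x. h t x \<partial>\<mu> t)"
      using slices(2)[OF Hm Hi]
      by (rule Bochner_Integration.integrable_cong[THEN iffD1, rotated -1]) (auto simp: hH')
    have "(\<integral>t. (\<integral>x. h t x \<partial>\<mu> t) \<partial>\<Lambda>) = (\<integral>t. (\<integral>x. H (t, x) \<partial>\<mu> t) \<partial>\<Lambda>)"
      by (intro Bochner_Integration.integral_cong) (auto simp: hH')
    then have s3: "(\<integral>t. (\<integral>x. h t x \<partial>\<mu> t) \<partial>\<Lambda>) = (\<integral>x. \<phi> (T, x) \<partial>\<mu> T) - (\<integral>x. \<phi> (0, x) \<partial>\<mu> 0)"
      using slices(3)[OF Hm Hi] int_H by simp
    have hm': "(\<lambda>t. \<integral>x. h t x \<partial>\<mu> t) \<in> borel_measurable (restrict_space lborel {0..T})"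
      using hm by (simp add: \<Lambda>_def)
    show "let h = (\<lambda>t x. \<phi>t (t, x) + \<phi>x (t, x) \<bullet> ctrl_field f0 f x (u t x)) in
          (AE t in lebesgue_on {0..T}. integrable (\<mu> t) (h t)) \<and>
          integrable (lebesgue_on {0..T}) (\<lambda>t. \<integral>x. h t x \<partial>\<mu> t) \<and>
          (\<integral>t. (\<integral>x. h t x \<partial>\<mu> t) \<partial>lebesgue_on {0..T})
            = (\<integral>x. \<phi> (T, x) \<partial>\<mu> T) - (\<integral>x. \<phi> (0, x) \<partial>\<mu> 0)"
      unfolding Let_def h_def[symmetric] AE_lebesgue_on_Icc lebesgue_on_Icc_borel_integral[OF hm']
      using s1 hm s3 unfolding \<Lambda>_def by blast
  qed
  then show ?thesis using Lp unfolding \<mu>_def by blast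
qed

text \<open>The cost is an iterated \<open>eintegral\<close>, so in the coercive case the lower
  bound is passed through \<open>eintegral_lower_bound\<close> twice, first over
  \<open>\<gamma>\<close> at a fixed time, then over time.\<close>

lemma tonelli_cost_integrable:
  fixes S :: "'z::topological_space \<Rightarrow> (real \<Rightarrow> real^'d) \<times> (real \<Rightarrow> real^'n)"
  assumes p: "p \<ge> 1" and L: "tonelli T U p L" and "prob_space \<gamma>"
    and wm: "(\<lambda>(t, z). S_ctrl T \<gamma> S t z) \<in> borel_measurable (borel \<Otimes>\<^sub>M \<gamma>)"
    and wU: "AE z in \<gamma>. AE t in lebesgue_on {0..T}. S_ctrl T \<gamma> S t z \<in> U"
    and cost: "total_cost T L \<gamma> S < \<infinity>"
  shows "integrable (restrict_space lborel {0..T} \<Otimes>\<^sub>M \<gamma>) (\<lambda>(t, z). norm (S_ctrl T \<gamma> S t z) powr p)"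
proof -
  interpret G: prob_space \<gamma> by fact
  define \<Lambda> where "\<Lambda> = restrict_space lborel {0..T}"
  interpret L: finite_measure \<Lambda> unfolding \<Lambda>_def by (rule finite_measure_lborel_Icc)
  interpret P: pair_sigma_finite \<Lambda> \<gamma> ..
  interpret m: finite_measure "\<Lambda> \<Otimes>\<^sub>M \<gamma>"
    by (intro finite_measure_pair_measure L.finite_measure_axioms G.finite_measure_axioms)
  define w where "w = S_ctrl T \<gamma> S"
  have U: "closed U" using L by (simp add: tonelli_def)
  note wm = wm[folded w_def]
  have wU1: "AE t in \<Lambda>. AE z in \<gamma>. w t z \<in> U"
    and wU2: "AE q in \<Lambda> \<Otimes>\<^sub>M \<gamma>. (case q of (t, z) \<Rightarrow> w t z) \<in> U"
    using AE_swap_closed[OF \<open>prob_space \<gamma>\<close> wm U wU[folded w_def]] by (simp_all only: \<Lambda>_def)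
  have wm': "(\<lambda>(t, z). w t z) \<in> borel_measurable (\<Lambda> \<Otimes>\<^sub>M \<gamma>)"
    using measurable_compose[OF measurable_lborel_Icc_pair wm] by (simp add: \<Lambda>_def)
  then have npm: "(\<lambda>(t, z). norm (w t z) powr p) \<in> borel_measurable (\<Lambda> \<Otimes>\<^sub>M \<gamma>)"
    by (simp add: case_prod_beta')
  have "(p > 1 \<and> (\<exists>\<alpha>>0. \<exists>\<beta>. \<forall>t\<in>{0..T}. \<forall>x. \<forall>u\<in>U. L t x u \<ge> \<alpha> * norm u powr p + \<beta>)) \<or> compact U"
    using L by (simp add: tonelli_def)
  then show ?thesis
    unfolding w_def[symmetric] \<Lambda>_def[symmetric]
  proof (elim disjE conjE exE)
    assume "compact U"
    then obtain B where "B > 0" and B: "\<And>u. u \<in> U \<Longrightarrow> norm u \<le> B"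
      using compact_imp_bounded bounded_pos by metis
    show "integrable (\<Lambda> \<Otimes>\<^sub>M \<gamma>) (\<lambda>(t, z). norm (w t z) powr p)"
    proof (rule m.integrable_const_bound[OF _ npm])
      show "AE q in \<Lambda> \<Otimes>\<^sub>M \<gamma>. norm (case q of (t, z) \<Rightarrow> norm (w t z) powr p) \<le> B powr p"
        using wU2 by eventually_elim (use B p in \<open>auto intro!: powr_mono2\<close>)
    qed
  next
    fix \<alpha> \<beta> assume "p > 1" "\<alpha> > 0"
      and coercive: "\<forall>t\<in>{0..T}. \<forall>x. \<forall>u\<in>U. L t x u \<ge> \<alpha> * norm u powr p + \<beta>"
    \<comment> \<open>The bound \<open>L \<ge> h - c\<close> loses \<open>2 * c\<close> under the
      integral over the probability measure \<open>\<gamma>\<close>; this loss is the constant of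
      the outer step, where it doubles again.\<close>
    define c where "c = \<bar>\<beta>\<bar>"
    define h where "h t z = ennreal (\<alpha> * norm (w t z) powr p)" for t z
    have hm: "(\<lambda>(t, z). h t z) \<in> borel_measurable (borel \<Otimes>\<^sub>M \<gamma>)"
      using wm by (simp add: h_def case_prod_beta')
    then have ht: "h t \<in> borel_measurable \<gamma>" for t using measurable_Pair2[OF hm, of t] by simp
    have inner: "enn2ereal (\<integral>\<^sup>+z. h t z \<partial>\<gamma>) - ereal (2 * c)
        \<le> eintegral \<gamma> (\<lambda>z. ereal (L t (S_traj S t z) (w t z)))"
      if t: "t \<in> {0..T}" and AE: "AE z in \<gamma>. w t z \<in> U" for t
    proof -
      have "AE z in \<gamma>. enn2ereal (h t z) - ereal c \<le> ereal (L t (S_traj S t z) (w t z))"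
        using AE
      proof eventually_elim
        case (elim z)
        then have "L t (S_traj S t z) (w t z) \<ge> \<alpha> * norm (w t z) powr p + \<beta>"
          using coercive t by blast
        then show ?case using \<open>\<alpha> > 0\<close> by (simp add: h_def c_def)
      qed
      then show ?thesis
        using eintegral_lower_bound[OF G.finite_measure_axioms ht, of c] by (simp add: c_def G.prob_space)
    qed
    have hb: "(\<lambda>t. \<integral>\<^sup>+z. h t z \<partial>\<gamma>) \<in> borel_measurable borel"
      using G.borel_measurable_nn_integral_fst[OF hm] by simp
    have "enn2ereal (\<integral>\<^sup>+t. (\<integral>\<^sup>+z. h t z \<partial>\<gamma>) \<partial>lebesgue_on {0..T})
        - ereal (2 * (2 * c) * measure (lebesgue_on {0..T}) (space (lebesgue_on {0..T})))
        \<le> total_cost T L \<gamma> S"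
      unfolding total_cost_def w_def[symmetric]
    proof (rule eintegral_lower_bound[OF finite_measure_lebesgue_on_Icc])
      show "(\<lambda>t. \<integral>\<^sup>+z. h t z \<partial>\<gamma>) \<in> borel_measurable (lebesgue_on {0..T})"
        using hb by (intro measurable_restrict_space1 measurable_completion) simp
      show "0 \<le> 2 * c" by (simp add: c_def)
      have "AE t in lebesgue_on {0..T}. t \<in> {0..T}" by (rule AE_I2) simp
      moreover have "AE t in lebesgue_on {0..T}. AE z in \<gamma>. w t z \<in> U"
        using wU1 by (simp only: AE_lebesgue_on_Icc \<Lambda>_def)
      ultimately show "AE t in lebesgue_on {0..T}. enn2ereal (\<integral>\<^sup>+z. h t z \<partial>\<gamma>) - ereal (2 * c)
          \<le> eintegral \<gamma> (\<lambda>z. ereal (L t (S_traj S t z) (w t z)))"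
        by eventually_elim (rule inner)
    qed
    \<comment> \<open>The subtracted term is finite, so the double integral of \<open>h\<close> must
      be finite too.\<close>
    also note cost
    finally have "enn2ereal (\<integral>\<^sup>+t. (\<integral>\<^sup>+z. h t z \<partial>\<gamma>) \<partial>lebesgue_on {0..T}) \<noteq> \<infinity>" by auto
    then have "(\<integral>\<^sup>+t. (\<integral>\<^sup>+z. h t z \<partial>\<gamma>) \<partial>lebesgue_on {0..T}) < \<infinity>"
      by (metis enn2ereal_top infinity_ennreal_def top.not_eq_extremum)
    also have "(\<integral>\<^sup>+t. (\<integral>\<^sup>+z. h t z \<partial>\<gamma>) \<partial>lebesgue_on {0..T}) = (\<integral>\<^sup>+t. (\<integral>\<^sup>+z. h t z \<partial>\<gamma>) \<partial>\<Lambda>)"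
      unfolding \<Lambda>_def by (simp add: nn_integral_restrict_space nn_integral_completion)
    also have "\<dots> = (\<integral>\<^sup>+q. (case q of (t, z) \<Rightarrow> h t z) \<partial>(\<Lambda> \<Otimes>\<^sub>M \<gamma>))"
      using measurable_compose[OF measurable_lborel_Icc_pair hm] by (subst G.nn_integral_fst[symmetric]) (auto simp: \<Lambda>_def)
    finally have "integrable (\<Lambda> \<Otimes>\<^sub>M \<gamma>) (\<lambda>(t, z). \<alpha> * norm (w t z) powr p)"
      using npm \<open>\<alpha> > 0\<close> by (intro integrableI_nonneg) (auto simp: h_def case_prod_beta')
    then show "integrable (\<Lambda> \<Otimes>\<^sub>M \<gamma>) (\<lambda>(t, z). norm (w t z) powr p)"
      using \<open>\<alpha> > 0\<close> by (simp add: case_prod_beta')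
  qed
qed

theorem corollary3p8:
  fixes T p :: real
    and U :: "(real^'n) set"
    and L :: "real \<Rightarrow> real^'d \<Rightarrow> real^'n \<Rightarrow> real"
    and f0 :: "real^'d \<Rightarrow> real^'d"
    and f :: "'n \<Rightarrow> real^'d \<Rightarrow> real^'d"
    and \<mu>0 \<mu>T :: "(real^'d) measure"
    and \<gamma> :: "((real^'d) \<times> (real^'d)) measure"
    and D :: "((real^'d) \<times> (real^'d)) set"
    and S :: "(real^'d) \<times> (real^'d) \<Rightarrow> (real \<Rightarrow> real^'d) \<times> (real \<Rightarrow> real^'n)"
  assumes "T > 0" and "p \<ge> 1"
    and "tonelli T U p L"
    and "sublinear_growth f0 f"
    and "\<mu>0 \<in> space (prob_algebra borel)" and "\<mu>T \<in> space (prob_algebra borel)"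
    and "\<gamma> \<in> couplings \<mu>0 \<mu>T"
    and "AE z in \<gamma>. z \<in> D"
    and "S \<in> restrict_space \<gamma> D \<rightarrow>\<^sub>M Omega_borel T U p f0 f"
    and "AE (x, y) in \<gamma>. S_traj S 0 (x, y) = x \<and> S_traj S T (x, y) = y"
    and "total_cost T L \<gamma> S < \<infinity>"
  shows "\<exists>\<mu> u. solves_continuity_equation T U f0 f \<mu> u \<and>
           \<mu> 0 = distr \<gamma> borel fst \<and> \<mu> T = distr \<gamma> borel snd \<and>
           (AE t in lebesgue_on {0..T}. u t \<in> Lp_functions (\<mu> t) p)"
proof -
  note T = \<open>T > 0\<close> and p = \<open>p \<ge> 1\<close>
  have prob: "prob_space \<gamma>" and sets_\<gamma>: "sets \<gamma> = sets borel"
    using \<open>\<gamma> \<in> couplings \<mu>0 \<mu>T\<close> by (auto simp: couplings_def space_prob_algebra)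
  interpret prob_space \<gamma> by fact
  have space_\<gamma>: "space \<gamma> = UNIV" using sets_eq_imp_space_eq[OF sets_\<gamma>] by simp
  have U: "closed U" "convex U" using \<open>tonelli T U p L\<close> by (auto simp: tonelli_def)
  \<comment> \<open>\<open>D\<close> may fail to be measurable, so it is replaced by
    \<open>D'\<close>, the complement of a null set that covers everything outside
    \<open>D\<close>.\<close>
  obtain N where N: "N \<in> null_sets \<gamma>" "{z. z \<notin> D} \<subseteq> N"
    using \<open>AE z in \<gamma>. z \<in> D\<close> by (auto simp: eventually_ae_filter space_\<gamma>)
  define D' where "D' = - N"
  have D': "D' \<in> sets \<gamma>" "D' \<subseteq> D" "AE z in \<gamma>. z \<in> D'"
    using N AE_not_in[OF N(1)] sets.compl_sets[of N \<gamma>]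
    by (auto simp: D'_def space_\<gamma> Compl_eq_Diff_UNIV null_setsD2)
  have "D' \<noteq> {}"
    using D'(3) emeasure_space_1 by (auto simp: eventually_False ae_filter_eq_bot_iff)
  then obtain z0 where z0: "z0 \<in> D'" by blast
  \<comment> \<open>A fixed admissible pair off \<open>D'\<close> makes the map measurable on the
    whole space and admissible for every \<open>z\<close>, not just for almost every one.\<close>
  define S' where "S' z = (if z \<in> D' then S z else S z0)" for z
  have SD': "S \<in> restrict_space \<gamma> D' \<rightarrow>\<^sub>M Omega_borel T U p f0 f"
    using assms(9) D'(2) by (rule measurable_restrict_mono)
  have "S z0 \<in> space (Omega_borel T U p f0 f)"
    using measurable_space[OF SD', of z0] z0 by (simp add: space_restrict_space space_\<gamma>)
  then have S': "S' \<in> \<gamma> \<rightarrow>\<^sub>M Omega_borel T U p f0 f"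
    using SD' D'(1) unfolding S'_def by (subst (asm) measurable_restrict_space_iff) (auto simp: space_\<gamma>)
  have S'_Omega: "S' z \<in> Omega T U p f0 f" for z
    using measurable_space[OF S', of z] by (simp add: space_\<gamma> Omega_borel_def space_measure_of_conv)
  have S'_eq: "AE z in \<gamma>. S' z = S z" using D'(3) by eventually_elim (simp add: S'_def)

  define X where "X t z = fst (S' z) (max 0 (min T t))" for t z
  have X_eq: "X t z = fst (S' z) t" if "t \<in> {0..T}" for t z using that by (simp add: X_def)
  have Xm: "(\<lambda>(t, z). X t z) \<in> borel_measurable (borel \<Otimes>\<^sub>M \<gamma>)"
    unfolding X_def using Omega_trajectory_jointly_measurable[OF T p S'] .
  have sets_pair: "sets (borel \<Otimes>\<^sub>M \<gamma>) = sets (borel :: (real \<times> ((real^'d) \<times> (real^'d))) measure)"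
    by (metis borel_prod sets_\<gamma> sets_pair_measure_cong)
  define w where "w = S_ctrl T \<gamma> S"
  obtain v where v: "(\<lambda>(t, z). v t z) \<in> borel_measurable (borel \<Otimes>\<^sub>M \<gamma>)"
    "\<And>z. z \<in> space \<gamma> \<Longrightarrow> AE t in lebesgue_on {0..T}. v t z = snd (S' z) t"
    using Omega_control_jointly_measurable[OF T p S'] by blast
  \<comment> \<open>\<open>S_ctrl\<close> is a choice whose defining property becomes available only
    once some representative is exhibited. The cost speaks of this choice, so \<open>w\<close>
    rather than \<open>v\<close> is used from here on.\<close>
  have "\<exists>v. (\<lambda>(t, z). v t z) \<in> borel_measurable borel \<and>
     (AE z in \<gamma>. AE t in lebesgue_on {0..T}. v t z = snd (S z) t)"
  proof (intro exI conjI)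
    show "(\<lambda>(t, z). v t z) \<in> borel_measurable borel"
      using v(1) measurable_cong_sets[OF sets_pair refl] by blast
    show "AE z in \<gamma>. AE t in lebesgue_on {0..T}. v t z = snd (S z) t"
      using S'_eq
    proof eventually_elim
      case (elim z)
      then show ?case using v(2)[of z] by (simp add: space_\<gamma>)
    qed
  qed
  from someI_ex[OF this] have "(\<lambda>(t, z). w t z) \<in> borel_measurable borel \<and>
     (AE z in \<gamma>. AE t in lebesgue_on {0..T}. w t z = snd (S z) t)"
    unfolding w_def S_ctrl_def .
  then have wm: "(\<lambda>(t, z). w t z) \<in> borel_measurable (borel \<Otimes>\<^sub>M \<gamma>)"
    and weq: "AE z in \<gamma>. AE t in lebesgue_on {0..T}. w t z = snd (S z) t"
    using measurable_cong_sets[OF sets_pair refl] by auto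
  \<comment> \<open>For almost every \<open>z\<close>, passing to \<open>w\<close> alters the
    control on a null set of times only, so the differential equation persists.\<close>
  have curves: "AE z in \<gamma>. absolutely_continuous_on 0 T (\<lambda>t. X t z) \<and>
      (AE t in lebesgue_on {0..T}. w t z \<in> U \<and>
        ((\<lambda>t. X t z) has_vector_derivative ctrl_field f0 f (X t z) (w t z)) (at t within {0..T}))"
    using weq S'_eq
  proof eventually_elim
    case (elim z)
    have Om: "absolutely_continuous_on 0 T (fst (S' z))" "AE t in lebesgue_on {0..T}. snd (S' z) t \<in> U"
      "AE t in lebesgue_on {0..T}. (fst (S' z) has_vector_derivative
          ctrl_field f0 f (fst (S' z) t) (snd (S' z) t)) (at t within {0..T})"
      using S'_Omega[of z] by (auto simp: Omega_def)
    have "AE t in lebesgue_on {0..T}. t \<in> {0..T}" by (rule AE_I2) simp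
    then have "AE t in lebesgue_on {0..T}. w t z \<in> U \<and>
        ((\<lambda>t. X t z) has_vector_derivative ctrl_field f0 f (X t z) (w t z)) (at t within {0..T})"
      using elim(1) Om(2,3)
    proof eventually_elim
      case (elim t)
      with \<open>S' z = S z\<close> show ?case
        by (auto simp: X_eq intro: has_vector_derivative_transform[OF _ X_eq])
    qed
    moreover have "absolutely_continuous_on 0 T (\<lambda>t. X t z)"
      by (rule absolutely_continuous_on_graph[OF Om(1), of 1]) (auto simp: X_eq)
    ultimately show ?case by blast
  qed
  then have "AE z in \<gamma>. AE t in lebesgue_on {0..T}. w t z \<in> U"
    by (rule eventually_mono) (erule conjE, erule eventually_mono, simp)
  then have wp: "integrable (restrict_space lborel {0..T} \<Otimes>\<^sub>M \<gamma>) (\<lambda>(t, z). norm (w t z) powr p)"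
    using tonelli_cost_integrable[OF p \<open>tonelli T U p L\<close> prob] wm assms(11) unfolding w_def by blast
  have Xc: "continuous_on {0..T} (\<lambda>t. X t z)" for z
  proof -
    have "continuous_on {0..T} (fst (S' z))" using S'_Omega[of z] by (auto simp: Omega_def)
    then show ?thesis by (rule continuous_on_eq) (simp add: X_eq)
  qed
  obtain u where u: "solves_continuity_equation T U f0 f (\<lambda>t. distr \<gamma> borel (X t)) u"
    "AE t in lebesgue_on {0..T}. u t \<in> Lp_functions (distr \<gamma> borel (X t)) p"
    using curves_solve_continuity_equation[OF T p U \<open>sublinear_growth f0 f\<close> prob Xm wm Xc curves wp] by blast
  have Xt: "X t \<in> borel_measurable \<gamma>" for t using measurable_Pair2[OF Xm, of t] by simp
  have fs: "fst \<in> borel_measurable \<gamma>" "snd \<in> borel_measurable \<gamma>"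
    unfolding measurable_cong_sets[OF sets_\<gamma> refl]
    by (intro borel_measurable_continuous_onI continuous_intros)+
  \<comment> \<open>The endpoints of the curves are prescribed almost surely; this determines the
    marginals, since image measures ignore null sets.\<close>
  have "AE z in \<gamma>. X 0 z = fst z \<and> X T z = snd z"
    using assms(10) S'_eq
    by eventually_elim (use T in \<open>auto simp: X_eq S_traj_def split: prod.splits\<close>)
  then have ends: "AE z in \<gamma>. X 0 z = fst z" "AE z in \<gamma>. X T z = snd z" by auto
  have "distr \<gamma> borel (X 0) = distr \<gamma> borel fst" "distr \<gamma> borel (X T) = distr \<gamma> borel snd"
    using ends Xt fs by (auto intro!: distr_cong_AE)
  with u show ?thesis by blast
qed

end
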